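(* Let $X=F^{-1}(0)\subseteq\mathbb K^{n+k}$ be the germ at the origin of an analytic space, with $Y$, $W$, $S$ as in the context, and let $\tilde X,\tilde W,\tilde Y$ be their Grassmann modifications as in the context. Then for each $r\ge 0$, $W$ (respectively $X$) is $(t^{r+1})$ regular over $Y$ at $0$ if and only if $\tilde W$ (respectively $\tilde X$) is $(t^r)$ regular over $\tilde Y$ at every point of $\tilde Y$. Moreover, every $(r+1)$-jet $z$ of direct transversals to $Y$ at $0$ lifts to an (in general non-unique) $r$-jet $\tilde z$ of a direct transversal to $\tilde Y$, and $W$ (respectively $X$) is $(t^{r+1})$ for $z$ if and only if $\tilde W$ (respectively $\tilde X$) is $(t^r)$ for $\tilde z$.
   Context: $\mathbb K$ is $\mathbb R$ or $\mathbb C$. $\mathbb K^{n+k}=\mathbb K^n\times\mathbb K^k$ has coordinates $(x_1,\dots,x_n,y_1,\dots,y_k)$ and $Y=\{0\}\times\mathbb K^k$. $F:(\mathbb K^{n+k},0)\to(\mathbb K^p,0)$ is an analytic map germ, $X=F^{-1}(0)$, $e$ is the codimension of $X\setminus Y$, $W$ is the Zariski open subset of $X\setminus Y$ of points where $F$ has rank $e$ (a smooth submanifold), and $S=X\setminus W$. It is assumed that $W$ is dense in $X\setminus Y$ in the metric topology. $(t^r)$ conditions. Let $P=\Gamma(f)$ be the graph of an analytic $f:(\mathbb K^n,0)\to(\mathbb K^k,0)$. For $r\ge1$, graphs of two $C^r$ map germs vanishing at $0$ are $r$-equivalent if the maps have the same $r$-jet at $0$. For $r=0$ one considers map germs vanishing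 at $0$ of class $C^{0,-1}$, i.e. continuous, $C^1$ except possibly at $0$, with $|g'(x)|=O(|x|^{-1})$; graphs of $f,g$ are $0$-equivalent if $|f'(x)-g'(x)|=o(|x|^{-1})$. Write $j^rP=j^rQ$ for $r$-equivalence; an equivalence class is an $r$-jet of a direct transversal to $Y$ at $0$. If $\mathbb K=\mathbb C$, $\mathbb C^n,\mathbb C^k$ are regarded as real spaces and the graphs $Q$ below are graphs of real $C^r$ (resp. $C^{0,-1}$) maps. $W$ is $(t^r)$ for $P$ if every $Q$ with $j^rQ=j^rP$ is transverse to $W$ at all points near (but not necessarily at) $0$. $X$ (more precisely $(X,S)$) is $(t^r)$ for $P$ if in addition every such $Q$ satisfies $Q\cap S=\{0\}$ as germs at $0$. These properties depend only on the $r$-jet of $P$, so one speaks of $(t^r)$ for an $r$-jet. Here $r$-jets considered are those of graphs of polynomial maps over $\mathbb K$ of degree $\le r$. $W$ (resp. $X$) is $(t^r)$ regular over $Y$ at $0$ if it is $(t^r)$ for $\Gamma(q)$ for every $\mathbb K$-polynomial map $q:\mathbb K^n\to\mathbb K^k$ of degree $\le r$ with $q(0)=0$ (for $r=0$ only $q=0$). At another point of the linear space the condition is defined by translating that point to the origin. Grassmann modification. Let $E_{n+k,n}$ be the canonical bundle over the Grassmannian $G_{n+k,n}$ of $n$-planes through $0$ in $\mathbb K^{n+k}$ (the fibre over a plane is the set of its points) and $\beta:E_{n+k,n}\to\mathbb K^{n+k}$ the natural projection. $G_{n+k,n}$ is embedded as the zero section, and $\tilde Y$ is the set of points of the zero section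 corresponding to planes that are direct transversals to $Y$ (i.e. transverse to $Y$ at $0$). Only a neighbourhood of $\tilde Y$ is considered; there one has coordinates $(x,a)\in\mathbb K^n\times\mathbb K^{nk}$, $a=(a_{i,j})_{1\le i\le k,1\le j\le n}$, in which $\beta(x,a)=(x,\sum_ja_{1,j}x_j,\dots,\sum_ja_{k,j}x_j)$ and $\tilde Y=\{x=0\}$. Set $\tilde X=\beta^{-1}(X)$, $\tilde W=\beta^{-1}(W)$, $\tilde S=\beta^{-1}(S)$; the $(t^r)$ conditions for $\tilde X$ over $\tilde Y$ refer to the pair $(\tilde X,\tilde S)$. If $z$ is the $(r+1)$-jet of $\Gamma(q)$ with $q:\mathbb K^n\to\mathbb K^k$ polynomial of degree $\le r+1$, $q(0)=0$, then a lift $\tilde z$ of $z$ is the $r$-jet, at the point $(0,p(0))\in\tilde Y$, of $\Gamma(p)$, where $p=(p_{i,j}):\mathbb K^n\to\mathbb K^{nk}$ is polynomial of degree $\le r$ with $\beta(\Gamma(p))=\Gamma(q)$, i.e. $q_i=\sum_jp_{i,j}x_j$. *)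

theory Defs
  imports "HOL-Analysis.Analysis"
begin

text \<open>
  The ground field is a type of sort real_normed_field, euclidean_space. By Frobenius' theorem
  these are exactly the reals and the complex numbers (up to isometric isomorphism); real and
  complex are both instances. Derivatives, differentiability classes and tangent vectors below are
  those of the underlying real spaces, whereas analyticity, polynomials, ranks and dimensions are
  taken over the ground field.

  A vector of the product of the coordinate spaces over 'n and 'm is indexed by the sum type, with
  x at the indices Inl and y at the indices Inr.
\<close>

definition join :: "'a^'n::finite \<Rightarrow> 'a^'m::finite \<Rightarrow> 'a^('n + 'm)" where
  "join x y = (\<chi> s. case s of Inl i \<Rightarrow> x $ i | Inr j \<Rightarrow> y $ j)"

definition Yspace :: "('a::zero^('n::finite + 'm::finite)) set" where
  "Yspace = {w. \<forall>i. w $ Inl i = 0}"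

definition graph_of :: "('a^'n::finite \<Rightarrow> 'a^'m::finite) \<Rightarrow> ('a^('n + 'm)) set" where
  "graph_of f = range (\<lambda>x. join x (f x))"

definition shift_to_origin :: "'b::ab_group_add \<Rightarrow> 'b set \<Rightarrow> 'b set" where
  "shift_to_origin c A = (\<lambda>w. w - c) ` A"


section \<open>Analytic and polynomial maps, codimension of a germ\<close>

definition monomial_at :: "('i::finite \<Rightarrow> nat) \<Rightarrow> 'a::comm_semiring_1^'i \<Rightarrow> 'a" where
  "monomial_at \<alpha> z = (\<Prod>i\<in>UNIV. (z $ i) ^ \<alpha> i)"

definition analytic_map_on ::
    "('a::{real_normed_field,euclidean_space}^'i::finite \<Rightarrow> 'a^'p::finite) \<Rightarrow> ('a^'i) set \<Rightarrow> bool" where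
  "analytic_map_on F U \<longleftrightarrow> (\<forall>w\<in>U. \<exists>c. \<forall>\<^sub>F z in nhds w.
     ((\<lambda>\<alpha>. monomial_at \<alpha> (z - w) *s c \<alpha>) has_sum F z) UNIV)"

definition polynomial_map ::
    "nat \<Rightarrow> ('a::comm_semiring_1^'i::finite \<Rightarrow> 'a^'p) \<Rightarrow> bool" where
  "polynomial_map r q \<longleftrightarrow>
     (\<exists>c. \<forall>x. q x = (\<Sum>\<alpha> | (\<Sum>i\<in>UNIV. \<alpha> i) \<le> r. monomial_at \<alpha> x *s c \<alpha>))"

text \<open>
  Analytic submanifolds of dimension d over the ground field, via charts that straighten them
  to linear subspaces.
\<close>

definition analytic_submanifold ::
    "nat \<Rightarrow> ('a::{real_normed_field,euclidean_space}^'i::finite) set \<Rightarrow> bool" where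
  "analytic_submanifold d (M :: ('a^'i) set) \<longleftrightarrow>
     (\<forall>w\<in>M. \<exists>V V' (\<phi> :: 'a^'i \<Rightarrow> 'a^'i) (\<psi> :: 'a^'i \<Rightarrow> 'a^'i) L.
     open V \<and> w \<in> V \<and> open V' \<and> homeomorphism V V' \<phi> \<psi> \<and>
     analytic_map_on \<phi> V \<and> analytic_map_on \<psi> V' \<and>
     vec.subspace L \<and> vec.dim L = d \<and> \<phi> ` (M \<inter> V) = L \<inter> V')"

text \<open>
  The dimension of the germ of A at 0 is the largest dimension of a nonempty submanifold contained
  in A arbitrarily close to 0. The Sup of the empty set is 0, so an empty germ has full
  codimension.
\<close>

definition germ_dim :: "('a::{real_normed_field,euclidean_space}^'i::finite) set \<Rightarrow> nat" where
  "germ_dim A = Sup {d. \<forall>V. open V \<and> 0 \<in> V \<longrightarrow>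
     (\<exists>M. M \<noteq> {} \<and> M \<subseteq> A \<inter> V \<and> analytic_submanifold d M)}"

definition germ_codim :: "('a::{real_normed_field,euclidean_space}^'i::finite) set \<Rightarrow> nat" where
  "germ_codim (A :: ('a^'i) set) = CARD('i) - germ_dim A"


section \<open>Differentiability classes and jets of map germs at the origin\<close>

text \<open>Iterated directional derivatives; v is the first direction of differentiation.\<close>

primrec iter_deriv ::
    "('b::real_normed_vector \<Rightarrow> 'c::real_normed_vector) \<Rightarrow> 'b list \<Rightarrow> 'b \<Rightarrow> 'c" where
  "iter_deriv f [] = f"
| "iter_deriv f (v # vs) = iter_deriv (\<lambda>x. frechet_derivative f (at x) v) vs"

text \<open>
  Class C^r on an open set. As the domains are finite dimensional, it suffices to consider
  directional derivatives.
\<close>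

definition Cr_on ::
    "nat \<Rightarrow> ('b::euclidean_space \<Rightarrow> 'c::real_normed_vector) \<Rightarrow> 'b set \<Rightarrow> bool" where
  "Cr_on r f U \<longleftrightarrow>
     (\<forall>vs. length vs \<le> r \<longrightarrow> continuous_on U (iter_deriv f vs)) \<and>
     (\<forall>vs. length vs < r \<longrightarrow> (\<forall>x\<in>U. iter_deriv f vs differentiable (at x)))"

text \<open>Germs vanishing at 0, of class C^r for r at least 1 and of class C^{0,-1} for r = 0.\<close>

definition Cr_germ ::
    "nat \<Rightarrow> ('b::euclidean_space \<Rightarrow> 'c::real_normed_vector) \<Rightarrow> bool" where
  "Cr_germ r g \<longleftrightarrow> g 0 = 0 \<and> (\<exists>U. open U \<and> 0 \<in> U \<and>
     (if r = 0
      then continuous_on U g \<and> Cr_on 1 g (U - {0}) \<and>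
           (\<lambda>x. onorm (frechet_derivative g (at x))) \<in> O[at 0](\<lambda>x. 1 / norm x)
      else Cr_on r g U))"

definition jet_equiv ::
    "nat \<Rightarrow> ('b::euclidean_space \<Rightarrow> 'c::real_normed_vector) \<Rightarrow> ('b \<Rightarrow> 'c) \<Rightarrow> bool" where
  "jet_equiv r f g \<longleftrightarrow>
     (if r = 0
      then (\<lambda>x. onorm (\<lambda>h. frechet_derivative f (at x) h - frechet_derivative g (at x) h))
             \<in> o[at 0](\<lambda>x. 1 / norm x)
      else (\<forall>vs. length vs \<le> r \<longrightarrow> iter_deriv f vs 0 = iter_deriv g vs 0))"


section \<open>Transversality and the conditions t^r\<close>

text \<open>For a submanifold A and w in A this is the (real) tangent space of A at w.\<close>

definition tangent_vectors :: "'b::real_normed_vector set \<Rightarrow> 'b \<Rightarrow> 'b set" where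
  "tangent_vectors A w = {v. \<exists>\<gamma> :: real \<Rightarrow> 'b.
     \<gamma> 0 = w \<and> (\<gamma> has_vector_derivative v) (at 0) \<and> (\<forall>\<^sub>F t in at 0. \<gamma> t \<in> A)}"

definition transverse_at :: "'b::real_normed_vector set \<Rightarrow> 'b set \<Rightarrow> 'b \<Rightarrow> bool" where
  "transverse_at Q W w \<longleftrightarrow>
     {u + v | u v. u \<in> tangent_vectors Q w \<and> v \<in> tangent_vectors W w} = UNIV"

text \<open>W is t^r for the graph of f, and the pair (X, S), with W = X - S, is t^r for the graph of f.\<close>

definition t_sub ::
    "nat \<Rightarrow> ('a::{real_normed_field,euclidean_space}^('n::finite + 'm::finite)) set
       \<Rightarrow> ('a^'n \<Rightarrow> 'a^'m) \<Rightarrow> bool" where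
  "t_sub r W f \<longleftrightarrow> (\<forall>g. Cr_germ r g \<and> jet_equiv r f g \<longrightarrow>
     (\<forall>\<^sub>F w in at 0. w \<in> graph_of g \<inter> W \<longrightarrow> transverse_at (graph_of g) W w))"

definition t_pair ::
    "nat \<Rightarrow> ('a::{real_normed_field,euclidean_space}^('n::finite + 'm::finite)) set
       \<Rightarrow> ('a^('n + 'm)) set \<Rightarrow> ('a^'n \<Rightarrow> 'a^'m) \<Rightarrow> bool" where
  "t_pair r X S f \<longleftrightarrow> t_sub r (X - S) f \<and>
     (\<forall>g. Cr_germ r g \<and> jet_equiv r f g \<longrightarrow>
        (\<forall>\<^sub>F w in nhds 0. w \<in> graph_of g \<inter> S \<longleftrightarrow> w = 0))"

text \<open>
  Regularity over Y at a point c of Y. For r = 0 the only polynomial map involved is q = 0.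
\<close>

definition t_regular_sub ::
    "nat \<Rightarrow> ('a::{real_normed_field,euclidean_space}^('n::finite + 'm::finite)) set
       \<Rightarrow> 'a^('n + 'm) \<Rightarrow> bool" where
  "t_regular_sub r W c \<longleftrightarrow>
     (\<forall>q. polynomial_map r q \<and> q 0 = 0 \<longrightarrow> t_sub r (shift_to_origin c W) q)"

definition t_regular_pair ::
    "nat \<Rightarrow> ('a::{real_normed_field,euclidean_space}^('n::finite + 'm::finite)) set
       \<Rightarrow> ('a^('n + 'm)) set \<Rightarrow> 'a^('n + 'm) \<Rightarrow> bool" where
  "t_regular_pair r X S c \<longleftrightarrow>
     (\<forall>q. polynomial_map r q \<and> q 0 = 0 \<longrightarrow>
        t_pair r (shift_to_origin c X) (shift_to_origin c S) q)"


section \<open>Grassmann modification\<close>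

text \<open>
  The planes that are direct transversals to Y are the graphs of the linear maps given by the k x n
  matrices a, and (x, a) stands for the point (x, a x) of the graph of a. In these coordinates of
  the canonical bundle near the planes transverse to Y, beta is the projection, and the
  modification of Y, i.e. the set x = 0, is again Yspace. The matrix a is a vector indexed by
  pairs (i, j), with i the row index.
\<close>

definition beta ::
    "'a::comm_semiring_1^('n::finite + ('k::finite \<times> 'n)) \<Rightarrow> 'a^('n + 'k)" where
  "beta w = join (\<chi> j. w $ Inl j) (\<chi> i. \<Sum>j\<in>UNIV. w $ Inr (i, j) * w $ Inl j)"

definition is_lift ::
    "nat \<Rightarrow> ('a::comm_semiring_1^'n::finite \<Rightarrow> 'a^'k::finite) \<Rightarrow> ('a^'n \<Rightarrow> 'a^('k \<times> 'n)) \<Rightarrow> bool" where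
  "is_lift r q p \<longleftrightarrow> polynomial_map r p \<and> beta ` graph_of p = graph_of q"

end

theory Submission
  imports Defs
begin

text \<open>
  Transversality of a graph to W at a point depends only on the 1-jet of the graph at that point.
  The 1-jets (x, g x, D g x) with x near 0 of the germs g having the r-jet of f are, up to passing
  to sparse sequences, exactly those with g x - f x = o(|x|^r) and D g x - D f x = o(|x|^(r-1)):
  one direction is Taylor's formula, the other interpolates by a sum of bump functions. So the
  condition t^r for f says that for some e > 0 all 1-jets within e of that of f, on these scales,
  are transverse to W. Now beta maps the graph of p to the graph of q x = p x * x, and
  multiplication by x carries the scale of order r for p to the scale of order r + 1 for q, with a
  linear right inverse of size 1 / |x|. Finally, beta is a submersion where x is nonzero, and so
  preserves and reflects transversality there.
\<close>

section \<open>Calculus of the classes C^r\<close>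

text \<open>What forces the passage to 1-jets is the step from W to its modification: for r >= 1 a
  germ p of class C^r gives a map p x * x which away from 0 is in general only C^r, not C^(r+1), so
  a germ upstairs cannot simply be pushed down. Its 1-jet at one point can, because a 1-jet carries
  no smoothness. The price is uniformity: to return to germs, a whole sequence of bad 1-jets has to
  be realised by one germ with the right r-jet. Working at single points also lets the right inverse
  of multiplication by x divide by a coordinate x_j with j depending on the point. The case r = 0 is
  separate only in the translation between germs and 1-jets. Its bound o(1 / |x|) on derivatives is
  the formula o(|x|^(r-1)) read at r = 0, so after multiplication by |x| all r share the same
  inequalities. Tangent vectors are velocities of curves, so the submersion property of beta is used
  by lifting curves.\<close>

text \<open>No differentiability is assumed: f and g have the same derivatives at x, so the choice
  operator behind \<open>frechet_derivative\<close> returns the same value also where there is no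
  derivative.\<close>

lemma frechet_derivative_cong_open:
  assumes "open U" "\<And>y. y \<in> U \<Longrightarrow> f y = g y" "x \<in> U"
  shows "frechet_derivative f (at x) = frechet_derivative g (at x)"
proof -
  have "(f has_derivative D) (at x) \<longleftrightarrow> (g has_derivative D) (at x)" for D
    using has_derivative_transform_within_open[OF _ assms(1,3)] assms(2) by metis
  then show ?thesis by (simp add: frechet_derivative_def)
qed

lemma iter_deriv_cong_open:
  assumes "open U" "\<And>y. y \<in> U \<Longrightarrow> f y = g y" "x \<in> U"
  shows "iter_deriv f vs x = iter_deriv g vs x"
  using assms(2,3)
proof (induction vs arbitrary: f g x)
  case (Cons v vs)
  have "iter_deriv (\<lambda>y. frechet_derivative f (at y) v) vs x
      = iter_deriv (\<lambda>y. frechet_derivative g (at y) v) vs x"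
    using frechet_derivative_cong_open[OF assms(1) Cons.prems(1)] Cons.prems(2)
    by (intro Cons.IH) auto
  then show ?case by simp
qed simp

lemma Cr_on_0: "Cr_on 0 f U \<longleftrightarrow> continuous_on U f"
  by (simp add: Cr_on_def)

text \<open>\<open>iter_deriv\<close> differentiates first in the direction at the head of the list,
  so peeling off the head turns the definition into a recursion on r. The closure properties below
  are inductions along it, with the functions generalised.\<close>

lemma Cr_on_Suc:
  "Cr_on (Suc r) f U \<longleftrightarrow> continuous_on U f \<and> (\<forall>x\<in>U. f differentiable (at x)) \<and>
     (\<forall>v. Cr_on r (\<lambda>x. frechet_derivative f (at x) v) U)" (is "?l \<longleftrightarrow> ?r")
proof
  assume l: ?l
  have "continuous_on U (iter_deriv f [])" "\<forall>x\<in>U. iter_deriv f [] differentiable (at x)"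
    using l unfolding Cr_on_def by (metis le0 list.size(3), metis list.size(3) zero_less_Suc)
  moreover have "Cr_on r (\<lambda>x. frechet_derivative f (at x) v) U" for v
    unfolding Cr_on_def
  proof (intro conjI allI impI)
    fix vs :: "'a list"
    assume "length vs \<le> r"
    then have "continuous_on U (iter_deriv f (v # vs))"
      using l unfolding Cr_on_def by (metis Suc_le_mono length_Cons)
    then show "continuous_on U (iter_deriv (\<lambda>x. frechet_derivative f (at x) v) vs)" by simp
  next
    fix vs :: "'a list"
    assume "length vs < r"
    then have "\<forall>x\<in>U. iter_deriv f (v # vs) differentiable (at x)"
      using l unfolding Cr_on_def by (metis Suc_less_eq length_Cons)
    then show "\<forall>x\<in>U. iter_deriv (\<lambda>x. frechet_derivative f (at x) v) vs differentiable (at x)"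
      by simp
  qed
  ultimately show ?r by simp
next
  assume r: ?r
  show ?l unfolding Cr_on_def
  proof (intro conjI allI impI)
    fix vs :: "'a list"
    assume "length vs \<le> Suc r"
    then show "continuous_on U (iter_deriv f vs)"
      using r by (cases vs) (auto simp: Cr_on_def)
  next
    fix vs :: "'a list"
    assume "length vs < Suc r"
    then show "\<forall>x\<in>U. iter_deriv f vs differentiable (at x)"
      using r by (cases vs) (auto simp: Cr_on_def)
  qed
qed

lemma Cr_on_mono: "Cr_on r f U \<Longrightarrow> s \<le> r \<Longrightarrow> V \<subseteq> U \<Longrightarrow> Cr_on s f V"
  unfolding Cr_on_def
  by (meson continuous_on_subset dual_order.trans dual_order.strict_trans1 subsetD)

lemma Cr_on_imp_continuous_on: "Cr_on r f U \<Longrightarrow> continuous_on U f"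
  using Cr_on_mono[of r f U 0 U] by (simp add: Cr_on_0)

lemma Cr_on_cong:
  assumes "open U" "\<And>y. y \<in> U \<Longrightarrow> f y = g y" "Cr_on r f U"
  shows "Cr_on r g U"
proof -
  have eq: "\<And>vs x. x \<in> U \<Longrightarrow> iter_deriv f vs x = iter_deriv g vs x"
    using iter_deriv_cong_open[OF assms(1,2)] .
  then have "iter_deriv f vs differentiable (at x) \<longleftrightarrow> iter_deriv g vs differentiable (at x)"
    if "x \<in> U" for vs x
    using that assms(1) unfolding differentiable_def
    by (metis has_derivative_transform_within_open)
  with eq assms(3) show ?thesis
    unfolding Cr_on_def by (metis continuous_on_cong)
qed

text \<open>Needed for the series of bumps, which near each point other than 0 coincides with one
  summand or with 0.\<close>

lemma Cr_on_local:
  assumes "\<And>x. x \<in> U \<Longrightarrow> \<exists>N. open N \<and> x \<in> N \<and> Cr_on r f N"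
  shows "Cr_on r f U"
  unfolding Cr_on_def
proof (intro conjI allI impI ballI)
  fix vs :: "'a list" assume vs: "length vs \<le> r"
  have "isCont (iter_deriv f vs) x" if "x \<in> U" for x
    using assms[OF that] vs unfolding Cr_on_def by (metis continuous_on_eq_continuous_at)
  then show "continuous_on U (iter_deriv f vs)" by (simp add: continuous_at_imp_continuous_on)
next
  fix vs :: "'a list" and x assume "length vs < r" "x \<in> U"
  then show "iter_deriv f vs differentiable (at x)"
    using assms unfolding Cr_on_def by blast
qed

lemma has_derivative_frechet:
  "f differentiable (at x) \<Longrightarrow> (f has_derivative (\<lambda>h. frechet_derivative f (at x) h)) (at x)"
  using frechet_derivative_works by auto

lemma frechet_derivative_eqI:
  "(f has_derivative D) (at x) \<Longrightarrow> frechet_derivative f (at x) v = D v"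
  by (metis frechet_derivative_at)

lemma iter_deriv_add:
  assumes "open U" "Cr_on r f U" "Cr_on r g U" "x \<in> U" "length vs \<le> r"
  shows "iter_deriv (\<lambda>x. f x + g x) vs x = iter_deriv f vs x + iter_deriv g vs x"
  using assms(2-5)
proof (induction vs arbitrary: f g r x)
  case (Cons v vs)
  then obtain s where r: "r = Suc s" by (cases r) auto
  have "iter_deriv (\<lambda>y. frechet_derivative (\<lambda>x. f x + g x) (at y) v) vs x =
        iter_deriv (\<lambda>y. frechet_derivative f (at y) v + frechet_derivative g (at y) v) vs x"
    using Cons.prems unfolding r Cr_on_Suc
    by (intro iter_deriv_cong_open[OF assms(1)] frechet_derivative_eqI)
       (auto intro!: has_derivative_add has_derivative_frechet)
  also have "\<dots> = iter_deriv f (v # vs) x + iter_deriv g (v # vs) x"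
    using Cons.prems unfolding r Cr_on_Suc by (auto intro!: Cons.IH)
  finally show ?case by simp
qed simp

lemma Cr_on_add:
  assumes "open U" "Cr_on r f U" "Cr_on r g U"
  shows "Cr_on r (\<lambda>x. f x + g x) U"
  using assms(2,3)
proof (induction r arbitrary: f g)
  case 0
  then show ?case by (auto simp: Cr_on_0 intro: continuous_on_add)
next
  case (Suc r)
  have "Cr_on r (\<lambda>x. frechet_derivative (\<lambda>x. f x + g x) (at x) v) U" for v
  proof (rule Cr_on_cong[OF assms(1)])
    show "Cr_on r (\<lambda>y. frechet_derivative f (at y) v + frechet_derivative g (at y) v) U"
      using Suc.prems by (auto simp: Cr_on_Suc intro!: Suc.IH)
  qed (use Suc.prems in \<open>auto simp: Cr_on_Suc intro!: frechet_derivative_eqI[symmetric] has_derivative_add has_derivative_frechet\<close>)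
  then show ?case
    using Suc.prems by (auto simp: Cr_on_Suc intro: continuous_on_add)
qed

lemma frechet_derivative_bilinear:
  assumes "bounded_bilinear B" "f differentiable (at x)" "g differentiable (at x)"
  shows "((\<lambda>x. B (f x) (g x)) has_derivative
    (\<lambda>v. B (f x) (frechet_derivative g (at x) v) + B (frechet_derivative f (at x) v) (g x))) (at x)"
  using assms by (auto intro!: bounded_bilinear.FDERIV has_derivative_frechet)

text \<open>By the product rule a derivative is a sum of two terms of the same shape in which one
  factor is left alone; hence f and g themselves are also lowered from class r + 1 to class
  r.\<close>

lemma Cr_on_bilinear:
  assumes B: "bounded_bilinear B" and "open U" "Cr_on r f U" "Cr_on r g U"
  shows "Cr_on r (\<lambda>x. B (f x) (g x)) U"
  using assms(3,4)
proof (induction r arbitrary: f g)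
  case 0
  then show ?case by (auto simp: Cr_on_0 intro: bounded_bilinear.continuous_on[OF B])
next
  case (Suc r)
  have f: "Cr_on r f U" and g: "Cr_on r g U" using Suc.prems by (auto elim!: Cr_on_mono)
  have "Cr_on r (\<lambda>x. frechet_derivative (\<lambda>x. B (f x) (g x)) (at x) v) U" for v
  proof (rule Cr_on_cong[OF assms(2)])
    show "Cr_on r (\<lambda>y. B (f y) (frechet_derivative g (at y) v)
                      + B (frechet_derivative f (at y) v) (g y)) U"
      using Suc.prems f g by (auto simp: Cr_on_Suc intro!: Suc.IH Cr_on_add assms(2))
  qed (use Suc.prems in \<open>auto simp: Cr_on_Suc intro!: frechet_derivative_eqI[symmetric]
         frechet_derivative_bilinear[OF B]\<close>)
  moreover have "\<forall>x\<in>U. (\<lambda>x. B (f x) (g x)) differentiable (at x)"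
    using Suc.prems unfolding Cr_on_Suc
    by (intro ballI differentiableI[OF frechet_derivative_bilinear[OF B, where f = f and g = g]]) blast+
  ultimately show ?case
    using Suc.prems by (simp add: Cr_on_Suc bounded_bilinear.continuous_on[OF B])
qed

lemma Cr_on_const: "Cr_on r (\<lambda>x. c) U"
proof (induction r arbitrary: c)
  case (Suc r)
  then show ?case by (simp add: Cr_on_Suc)
qed (simp add: Cr_on_0)

lemma Cr_on_bounded_linear:
  assumes "bounded_linear T" shows "Cr_on r T U"
proof (cases r)
  case (Suc s)
  have "frechet_derivative T (at x) = T" for x
    using assms by (metis bounded_linear_imp_has_derivative frechet_derivative_at)
  with Suc assms show ?thesis
    by (auto simp: Cr_on_Suc Cr_on_const linear_continuous_on bounded_linear_imp_differentiable)
qed (use assms in \<open>simp add: Cr_on_0 linear_continuous_on\<close>)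

lemma Cr_on_compose_bounded_linear:
  assumes T: "bounded_linear T" and "open U" "Cr_on r f U"
  shows "Cr_on r (\<lambda>x. T (f x)) U"
  using assms(3)
proof (induction r arbitrary: f)
  case 0
  then show ?case by (auto simp: Cr_on_0 intro: bounded_linear.continuous_on[OF T])
next
  case (Suc r)
  have "Cr_on r (\<lambda>x. frechet_derivative (\<lambda>x. T (f x)) (at x) v) U" for v
  proof (rule Cr_on_cong[OF assms(2)])
    show "Cr_on r (\<lambda>y. T (frechet_derivative f (at y) v)) U"
      using Suc.prems by (auto simp: Cr_on_Suc intro!: Suc.IH)
  qed (use Suc.prems in \<open>auto simp: Cr_on_Suc intro!: frechet_derivative_eqI[symmetric]
        bounded_linear.has_derivative[OF T] has_derivative_frechet\<close>)
  moreover have "\<forall>x\<in>U. (\<lambda>x. T (f x)) differentiable (at x)"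
    using Suc.prems unfolding Cr_on_Suc
    by (intro ballI differentiableI[OF bounded_linear.has_derivative[OF T has_derivative_frechet[of f]]]) blast
  ultimately show ?case
    using Suc.prems by (simp add: Cr_on_Suc bounded_linear.continuous_on[OF T])
qed

lemma Cr_on_sum:
  assumes "open U" "\<And>i. i \<in> I \<Longrightarrow> Cr_on r (f i) U"
  shows "Cr_on r (\<lambda>x. \<Sum>i\<in>I. f i x) U"
  using assms(2)
  by (induction I rule: infinite_finite_induct) (auto intro: Cr_on_const Cr_on_add[OF assms(1)])

lemma iter_deriv_zero [simp]: "iter_deriv (\<lambda>x. 0) vs = (\<lambda>x. 0)"
  by (induction vs) auto

text \<open>The scalar factor absorbs the powers of the scale produced by each differentiation.\<close>

lemma Cr_on_affine_scaling:
  assumes "Cr_on r f UNIV" "\<rho> \<noteq> 0"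
  shows "Cr_on r (\<lambda>x. c *\<^sub>R f ((x - a) /\<^sub>R \<rho>)) UNIV"
    and "length vs \<le> r \<Longrightarrow> iter_deriv (\<lambda>x. c *\<^sub>R f ((x - a) /\<^sub>R \<rho>)) vs x
           = (c / \<rho> ^ length vs) *\<^sub>R iter_deriv f vs ((x - a) /\<^sub>R \<rho>)"
proof -
  have der: "((\<lambda>x. c *\<^sub>R f ((x - a) /\<^sub>R \<rho>)) has_derivative
      (\<lambda>v. (c / \<rho>) *\<^sub>R frechet_derivative f (at ((y - a) /\<^sub>R \<rho>)) v)) (at y)"
    if "Cr_on (Suc s) f UNIV" for f :: "'a \<Rightarrow> 'b" and c s y
  proof -
    have D: "(f has_derivative frechet_derivative f (at ((y - a) /\<^sub>R \<rho>))) (at ((y - a) /\<^sub>R \<rho>))"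
      using that by (simp add: Cr_on_Suc frechet_derivative_works)
    have "((\<lambda>x. f ((x - a) /\<^sub>R \<rho>)) has_derivative
        (\<lambda>v. frechet_derivative f (at ((y - a) /\<^sub>R \<rho>)) (v /\<^sub>R \<rho>))) (at y)"
    proof (rule has_derivative_compose[where f = "\<lambda>x. (x - a) /\<^sub>R \<rho>" and g = f])
      show "((\<lambda>x. (x - a) /\<^sub>R \<rho>) has_derivative (\<lambda>v. v /\<^sub>R \<rho>)) (at y)"
        by (auto intro!: derivative_eq_intros)
    qed (rule D)
    moreover have "linear (frechet_derivative f (at ((y - a) /\<^sub>R \<rho>)))"
      using D has_derivative_linear by blast
    ultimately have "((\<lambda>x. f ((x - a) /\<^sub>R \<rho>)) has_derivative
        (\<lambda>v. frechet_derivative f (at ((y - a) /\<^sub>R \<rho>)) v /\<^sub>R \<rho>)) (at y)"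
      by (simp add: linear_scale)
    from has_derivative_scaleR_right[OF this, of c] show ?thesis by (simp add: divide_inverse)
  qed
  show "Cr_on r (\<lambda>x. c *\<^sub>R f ((x - a) /\<^sub>R \<rho>)) UNIV"
    using assms(1)
  proof (induction r arbitrary: f c)
    case 0
    then have f: "continuous_on UNIV f" by (simp add: Cr_on_0)
    show ?case unfolding Cr_on_0
      by (intro continuous_intros continuous_on_compose2[OF f]) auto
  next
    case (Suc r)
    note d = der[OF Suc.prems]
    have "(\<lambda>x. frechet_derivative (\<lambda>x. c *\<^sub>R f ((x - a) /\<^sub>R \<rho>)) (at x) v) =
          (\<lambda>x. (c / \<rho>) *\<^sub>R frechet_derivative f (at ((x - a) /\<^sub>R \<rho>)) v)" for v
      using frechet_derivative_eqI[OF d] by blast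
    moreover have "Cr_on r (\<lambda>x. frechet_derivative f (at x) v) UNIV" for v
      using Suc.prems by (simp add: Cr_on_Suc)
    moreover have "continuous_on UNIV (\<lambda>x. c *\<^sub>R f ((x - a) /\<^sub>R \<rho>))"
      using d has_derivative_continuous by (metis continuous_at_imp_continuous_on)
    moreover have "(\<lambda>x. c *\<^sub>R f ((x - a) /\<^sub>R \<rho>)) differentiable (at x)" for x
      using d unfolding differentiable_def by blast
    ultimately show ?case
      using Suc.IH[of "\<lambda>x. frechet_derivative f (at x) v" "c / \<rho>" for v] by (simp add: Cr_on_Suc)
  qed
  show "iter_deriv (\<lambda>x. c *\<^sub>R f ((x - a) /\<^sub>R \<rho>)) vs x
           = (c / \<rho> ^ length vs) *\<^sub>R iter_deriv f vs ((x - a) /\<^sub>R \<rho>)" if "length vs \<le> r"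
    using assms(1) that
  proof (induction vs arbitrary: f c r)
    case (Cons v vs)
    then obtain s where r: "r = Suc s" by (cases r) auto
    note d = der[OF Cons.prems(1)[unfolded r]]
    have "(\<lambda>x. frechet_derivative (\<lambda>x. c *\<^sub>R f ((x - a) /\<^sub>R \<rho>)) (at x) v) =
          (\<lambda>x. (c / \<rho>) *\<^sub>R frechet_derivative f (at ((x - a) /\<^sub>R \<rho>)) v)"
      using frechet_derivative_eqI[OF d] by blast
    moreover have "Cr_on s (\<lambda>x. frechet_derivative f (at x) v) UNIV"
      using Cons.prems by (simp add: Cr_on_Suc r)
    ultimately show ?case
      using Cons.IH[of s "\<lambda>x. frechet_derivative f (at x) v" "c / \<rho>"] Cons.prems(2) r
      by (simp add: divide_divide_eq_left)
  qed simp
qed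

section \<open>Germs with vanishing jet\<close>

text \<open>\<open>iter_deriv\<close> only gives access to directional derivatives; this passes from
  the finitely many basis directions to the whole differential.\<close>

lemma linear_norm_le_sum_Basis:
  fixes L :: "'b::euclidean_space \<Rightarrow> 'c::real_normed_vector"
  assumes "linear L"
  shows "norm (L h) \<le> (\<Sum>b\<in>Basis. norm (L b)) * norm h"
proof -
  have L: "bounded_linear L" using assms by (simp add: linear_conv_bounded_linear)
  show ?thesis
    using onorm[OF L, of h] mult_right_mono[OF onorm_componentwise[OF L], of "norm h"] by simp
qed

text \<open>The mean value inequality on the segment from 0 to x. At the end point 0 only continuity
  is required, so it applies to functions whose differentiability at 0 is still to be
  proved.\<close>

lemma norm_le_if_derivative_le:
  fixes h :: "'b::euclidean_space \<Rightarrow> 'c::real_inner"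
  assumes "isCont h 0" "h 0 = 0"
    and der: "\<And>y. 0 < norm y \<Longrightarrow> norm y \<le> norm x \<Longrightarrow> (h has_derivative D y) (at y)"
    and bd: "\<And>y v. 0 < norm y \<Longrightarrow> norm y \<le> norm x \<Longrightarrow> norm (D y v) \<le> e * norm v"
  shows "norm (h x) \<le> e * norm x"
proof (cases "x = 0")
  case False
  have *: "((\<lambda>t. h (t *\<^sub>R x)) has_derivative (\<lambda>s. D (t *\<^sub>R x) (s *\<^sub>R x))) (at t)"
    if "0 < t" "t \<le> 1" for t
  proof (rule has_derivative_compose[where g = h])
    show "((\<lambda>t. t *\<^sub>R x) has_derivative (\<lambda>s. s *\<^sub>R x)) (at t)"
      by (auto intro!: derivative_eq_intros)
    have "norm (t *\<^sub>R x) \<le> norm x" using that mult_right_mono[of t 1 "norm x"] by simp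
    then show "(h has_derivative D (t *\<^sub>R x)) (at (t *\<^sub>R x))"
      using that False by (intro der) (auto simp del: norm_scaleR)
  qed
  have "isCont (\<lambda>t. h (t *\<^sub>R x)) t" if "t \<in> {0..1}" for t :: real
  proof (cases "t = 0")
    case True
    then show ?thesis using assms(1) by (intro continuous_at_compose[unfolded o_def, of t "\<lambda>t. t *\<^sub>R x" h]) auto
  next
    case False
    with that show ?thesis by (intro has_derivative_continuous[OF *]) auto
  qed
  then have "continuous_on {0..1} (\<lambda>t. h (t *\<^sub>R x))" by (simp add: continuous_at_imp_continuous_on)
  from mvt_general[OF zero_less_one this *] obtain t where
    t: "0 < t" "t < 1" "norm (h (1 *\<^sub>R x) - h (0 *\<^sub>R x)) \<le> norm (D (t *\<^sub>R x) ((1 - 0) *\<^sub>R x))" by auto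
  have "norm (t *\<^sub>R x) < norm x" using t(1,2) False mult_strict_right_mono[of t 1 "norm x"] by simp
  then have "norm (D (t *\<^sub>R x) x) \<le> e * norm x"
    using t False by (intro bd) (auto simp del: norm_scaleR)
  with t assms(2) show ?thesis by simp
qed (use assms(2) in simp)

text \<open>Flat germs are first controlled off 0 only. If the derivative tends to 0 at 0, the mean
  value inequality bounds |h y| by e * |y| near 0, so h has derivative 0 there; the directional
  derivatives then satisfy the same hypotheses with one order less.\<close>

lemma Cr_on_removable:
  fixes h :: "'b::euclidean_space \<Rightarrow> 'c::real_inner"
  assumes "Cr_on r h (- {0})" "h 0 = 0"
    and "\<And>vs. length vs \<le> r \<Longrightarrow> (iter_deriv h vs \<longlongrightarrow> 0) (at 0)"
  shows "Cr_on r h UNIV \<and> (\<forall>vs. length vs \<le> r \<longrightarrow> iter_deriv h vs 0 = 0)"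
  using assms
proof (induction r arbitrary: h)
  have cont: "continuous_on UNIV h"
    if "continuous_on (- {0}) h" "h 0 = 0" "(h \<longlongrightarrow> 0) (at 0)" for h :: "'b \<Rightarrow> 'c"
  proof -
    have "isCont h x" for x
    proof (cases "x = 0")
      case False
      then show ?thesis using that(1) by (simp add: continuous_on_eq_continuous_at open_Compl)
    qed (use that in \<open>simp add: isCont_def\<close>)
    then show ?thesis by (simp add: continuous_at_imp_continuous_on)
  qed
  {
    case 0
    then show ?case using cont[of h] "0.prems"(3)[of "[]"] by (simp add: Cr_on_0)
  next
    case (Suc r)
    let ?D = "\<lambda>x. frechet_derivative h (at x)"
    have cont_h: "continuous_on UNIV h"
      using cont[of h] Suc.prems(3)[of "[]"] Suc.prems(1,2) by (simp add: Cr_on_Suc)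
    have der: "(h has_derivative ?D x) (at x)" if "x \<noteq> 0" for x
      using Suc.prems(1) that by (simp add: Cr_on_Suc frechet_derivative_works)
    have der0: "(h has_derivative (\<lambda>_. 0)) (at 0)"
      unfolding has_derivative_at_alt
    proof (intro conjI allI impI)
      fix e :: real assume "e > 0"
      have "\<forall>\<^sub>F y in at 0. \<forall>b\<in>Basis. norm (?D y b) < e / DIM('b)"
      proof (intro eventually_ball_finite ballI)
        fix b :: 'b
        have "((\<lambda>y. ?D y b) \<longlongrightarrow> 0) (at 0)" using Suc.prems(3)[of "[b]"] by simp
        from tendstoD[OF this, of "e / DIM('b)"] \<open>e > 0\<close>
        show "\<forall>\<^sub>F y in at 0. norm (?D y b) < e / DIM('b)" by simp
      qed simp
      then obtain d where d: "d > 0"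
        "\<And>y b. y \<noteq> 0 \<Longrightarrow> norm y < d \<Longrightarrow> b \<in> Basis \<Longrightarrow> norm (?D y b) < e / DIM('b)"
        by (auto simp: eventually_at)
      have "norm (?D y v) \<le> e * norm v" if "0 < norm y" "norm y < d" for y v
      proof -
        have "(\<Sum>b\<in>Basis. norm (?D y b)) \<le> (\<Sum>b\<in>(Basis::'b set). e / DIM('b))"
          using d(2)[of y] that by (intro sum_mono) (simp add: less_imp_le)
        also have "\<dots> = e" by simp
        finally show ?thesis
          using linear_norm_le_sum_Basis[OF has_derivative_linear[OF der[of y]], of v]
            mult_right_mono[of _ e "norm v"] that by fastforce
      qed
      then have "norm (h y) \<le> e * norm y" if "norm y < d" for y
        using that der cont_h Suc.prems(2)
        by (intro norm_le_if_derivative_le[of h y ?D e])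
           (auto simp: continuous_on_eq_continuous_at)
      with d(1) Suc.prems(2)
      show "\<exists>d>0. \<forall>y. norm (y - 0) < d \<longrightarrow> norm (h y - h 0 - 0) \<le> e * norm (y - 0)" by auto
    qed simp
    have "Cr_on r (\<lambda>x. ?D x v) UNIV \<and>
      (\<forall>vs. length vs \<le> r \<longrightarrow> iter_deriv (\<lambda>x. ?D x v) vs 0 = 0)" for v
    proof (rule Suc.IH)
      show "Cr_on r (\<lambda>x. ?D x v) (- {0})" using Suc.prems(1) by (simp add: Cr_on_Suc)
      show "?D 0 v = 0" using frechet_derivative_eqI[OF der0] .
      show "(iter_deriv (\<lambda>x. ?D x v) vs \<longlongrightarrow> 0) (at 0)" if "length vs \<le> r" for vs
        using Suc.prems(3)[of "v # vs"] that by simp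
    qed
    moreover have "h differentiable (at x)" for x
      using der der0 by (cases "x = 0") (auto simp: differentiable_def)
    moreover have "iter_deriv h vs 0 = 0"
      if "\<forall>v ws. length ws \<le> r \<longrightarrow> iter_deriv (\<lambda>x. ?D x v) ws 0 = 0" "length vs \<le> Suc r" for vs
      using that Suc.prems(2) by (cases vs) auto
    ultimately show ?case using cont_h by (auto simp: Cr_on_Suc)
  }
qed

text \<open>For r = 0 vanishing of the jet means that the derivative is o(1 / |x|).\<close>

definition flat_germ :: "nat \<Rightarrow> ('b::euclidean_space \<Rightarrow> 'c::real_normed_vector) \<Rightarrow> bool" where
  "flat_germ r h \<longleftrightarrow> Cr_germ r h \<and> jet_equiv r (\<lambda>_. 0) h"

lemma frechet_derivative_smallo_inverse:
  fixes h :: "'b::euclidean_space \<Rightarrow> 'c::real_normed_vector"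
  assumes "\<And>y. y \<noteq> 0 \<Longrightarrow> h differentiable (at y)"
    and "\<And>b e. e > 0 \<Longrightarrow> \<forall>\<^sub>F y in at 0. norm y * norm (frechet_derivative h (at y) b) \<le> e"
  shows "(\<lambda>x. onorm (frechet_derivative h (at x))) \<in> o[at 0](\<lambda>x. 1 / norm x)"
proof (rule landau_o.smallI)
  fix c :: real assume "c > 0"
  have "\<forall>\<^sub>F y in at 0. \<forall>b\<in>Basis. norm y * norm (frechet_derivative h (at y) b) \<le> c / DIM('b)"
    using \<open>c > 0\<close> by (intro eventually_ball_finite ballI assms(2)) auto
  moreover have "\<forall>\<^sub>F y in at 0. y \<noteq> (0::'b)" by (simp add: eventually_at_filter)
  ultimately show "\<forall>\<^sub>F y in at 0. norm (onorm (frechet_derivative h (at y))) \<le> c * norm (1 / norm y)"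
  proof eventually_elim
    case (elim y)
    let ?D = "frechet_derivative h (at y)"
    have D: "bounded_linear ?D"
      using assms(1)[OF elim(2)] by (metis frechet_derivative_works has_derivative_bounded_linear)
    have "norm y * (\<Sum>b\<in>Basis. norm (?D b)) \<le> (\<Sum>b\<in>(Basis::'b set). c / DIM('b))"
      unfolding sum_distrib_left using elim(1) by (intro sum_mono) auto
    also have "\<dots> = c" by simp
    finally have "norm y * onorm ?D \<le> c"
      using onorm_componentwise[OF D] by (meson mult_left_mono norm_ge_zero order_trans)
    with elim(2) onorm_pos_le[OF D] show ?case by (simp add: field_simps)
  qed
qed

text \<open>Each differentiation may cost one power of |y|. Up to order r this still lets all
  derivatives tend to 0, so the singularity at 0 is removable. The orders run to r + 1 because the
  class for r = 0 involves the first derivative: the bound on |y| times it is then the o(1 / |x|)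
  condition.\<close>

lemma flat_germI:
  fixes h :: "'b::euclidean_space \<Rightarrow> 'c::real_inner"
  assumes C: "Cr_on (Suc r) h (- {0})" and h0: "h 0 = 0"
    and small: "\<And>vs e. length vs \<le> Suc r \<Longrightarrow> e > 0 \<Longrightarrow>
      \<forall>\<^sub>F y in at 0. norm y ^ length vs * norm (iter_deriv h vs y) \<le> e * norm y ^ r"
  shows "flat_germ r h"
proof (cases r)
  case 0
  have diff: "h differentiable (at y)" if "y \<noteq> 0" for y
    using C that by (simp add: Cr_on_Suc)
  have o: "(\<lambda>x. onorm (frechet_derivative h (at x))) \<in> o[at 0](\<lambda>x. 1 / norm x)"
    using small[of "[_]"] 0 by (intro frechet_derivative_smallo_inverse diff) auto
  have lim: "(h \<longlongrightarrow> 0) (at 0)"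
  proof (rule tendstoI)
    fix e :: real assume "e > 0"
    then have "e / 2 > 0" by simp
    from small[of "[]", OF _ this]
    have "\<forall>\<^sub>F y in at 0. norm (h y) \<le> e / 2" using 0 by simp
    then show "\<forall>\<^sub>F y in at 0. dist (h y) 0 < e"
      by eventually_elim (use \<open>e > 0\<close> in auto)
  qed
  have "Cr_on 0 h UNIV"
    using Cr_on_removable[of 0 h] lim h0 C Cr_on_mono[of "Suc r" h "- {0}" 0 "- {0}"] by auto
  then have "continuous_on UNIV h" by (simp add: Cr_on_0)
  moreover have "Cr_on 1 h (UNIV - {0})" using C 0 by (simp add: Compl_eq_Diff_UNIV)
  moreover have "jet_equiv 0 (\<lambda>_. 0) h"
    using o by (simp add: jet_equiv_def onorm_neg)
  ultimately show ?thesis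
    using 0 h0 landau_o.small_imp_big[OF o] unfolding flat_germ_def Cr_germ_def by auto
next
  case (Suc s)
  have "(iter_deriv h vs \<longlongrightarrow> 0) (at 0)" if "length vs \<le> r" for vs
  proof (rule tendstoI)
    fix e :: real assume "e > 0"
    then have "e / 2 > 0" by simp
    from small[OF _ this, of vs] that
    have "\<forall>\<^sub>F y in at 0. norm y ^ length vs * norm (iter_deriv h vs y) \<le> e / 2 * norm y ^ r" by simp
    moreover have "\<forall>\<^sub>F y in at 0. y \<noteq> (0::'b) \<and> norm y < 1"
      by (auto simp: eventually_at intro!: exI[of _ 1])
    ultimately show "\<forall>\<^sub>F y in at 0. dist (iter_deriv h vs y) 0 < e"
    proof eventually_elim
      case (elim y)
      have "norm y ^ r \<le> norm y ^ length vs" using elim(2) that by (intro power_decreasing) auto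
      then have "norm y ^ length vs * norm (iter_deriv h vs y) \<le> norm y ^ length vs * (e / 2)"
        using elim(1) \<open>e > 0\<close>
        by (smt (verit) mult.commute mult_left_mono half_gt_zero)
      then have "norm (iter_deriv h vs y) \<le> e / 2" using elim(2) by simp
      then show ?case using \<open>e > 0\<close> by simp
    qed
  qed
  then have "Cr_on r h UNIV \<and> (\<forall>vs. length vs \<le> r \<longrightarrow> iter_deriv h vs 0 = 0)"
    using C h0 by (intro Cr_on_removable) (auto elim!: Cr_on_mono)
  then show ?thesis using Suc h0 unfolding flat_germ_def Cr_germ_def jet_equiv_def by auto
qed

section \<open>Bump functions and the interpolation of 1-jets by a germ with vanishing jet\<close>

lemma Cr_on_scaleR_affine:
  fixes \<phi> :: "'b::euclidean_space \<Rightarrow> real" and L :: "'b \<Rightarrow> 'c::real_normed_vector"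
  assumes "Cr_on m \<phi> UNIV" "linear L"
  shows "Cr_on m (\<lambda>z. \<phi> z *\<^sub>R (v + L z)) UNIV"
  using assms(2) unfolding linear_conv_bounded_linear
  by (rule Cr_on_bilinear[OF bounded_bilinear_scaleR open_UNIV assms(1)
        Cr_on_add[OF open_UNIV Cr_on_const Cr_on_bounded_linear]])

text \<open>C depends on \<phi>, K and the directions but not on v and L, so that one constant
  serves all summands of the series of bumps. Products of a function and an affine map are stable
  under differentiation: the derivative in direction w is \<phi> times the constant L w plus the
  derivative of \<phi> times the same affine map.\<close>

lemma iter_deriv_mult_affine_bound:
  fixes \<phi> :: "'b::euclidean_space \<Rightarrow> real"
  assumes "Cr_on m \<phi> UNIV" "compact K" "length vs \<le> m"
  shows "\<exists>C\<ge>0. \<forall>v (L :: 'b \<Rightarrow> 'c::real_normed_vector) B z.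
     linear L \<and> norm v \<le> B \<and> (\<forall>h. norm (L h) \<le> B * norm h) \<and> z \<in> K \<longrightarrow>
     norm (iter_deriv (\<lambda>z. \<phi> z *\<^sub>R (v + L z)) vs z) \<le> C * B"
  using assms(1,3)
proof (induction vs arbitrary: \<phi> m)
  case Nil
  have "continuous_on K \<phi>" using Cr_on_imp_continuous_on[OF Nil.prems(1)] continuous_on_subset by blast
  then have "bounded (\<phi> ` K)" using assms(2) compact_continuous_image compact_imp_bounded by blast
  then obtain A where A: "A > 0" "\<And>z. z \<in> K \<Longrightarrow> norm (\<phi> z) \<le> A" by (auto simp: bounded_pos)
  obtain R where R: "R > 0" "\<And>z. z \<in> K \<Longrightarrow> norm z \<le> R"
    using compact_imp_bounded[OF assms(2)] by (auto simp: bounded_pos)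
  have "norm (\<phi> z *\<^sub>R (v + L z)) \<le> (A * (1 + R)) * B"
    if "norm v \<le> B" "\<forall>h. norm (L h) \<le> B * norm h" "z \<in> K" for v z B and L :: "'b \<Rightarrow> 'c"
  proof -
    have B: "B \<ge> 0" using that(1) norm_ge_zero order_trans by blast
    have "norm (v + L z) \<le> B + B * R"
      using that R(2) B by (meson add_mono mult_left_mono norm_triangle_le order_trans)
    then have "norm (\<phi> z) * norm (v + L z) \<le> A * (B + B * R)"
      using A that(3) by (intro mult_mono) auto
    then show ?thesis by (simp add: distrib_left mult_ac)
  qed
  then show ?case using A(1) R(1) by (intro exI[of _ "A * (1 + R)"]) auto
next
  case (Cons w vs)
  then obtain s where m: "m = Suc s" by (cases m) auto
  have p: "Cr_on s \<phi> UNIV" and Dp: "Cr_on s (\<lambda>x. frechet_derivative \<phi> (at x) w) UNIV"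
    and dp: "\<And>x. \<phi> differentiable (at x)" and ls: "length vs \<le> s"
    using Cons.prems Cr_on_mono[of m \<phi> UNIV s UNIV] m by (auto simp: Cr_on_Suc)
  from Cons.IH[OF p ls] obtain C1 where C1: "C1 \<ge> 0"
    "\<forall>v (L :: 'b \<Rightarrow> 'c) B z.
     linear L \<and> norm v \<le> B \<and> (\<forall>h. norm (L h) \<le> B * norm h) \<and> z \<in> K \<longrightarrow>
     norm (iter_deriv (\<lambda>z. \<phi> z *\<^sub>R (v + L z)) vs z) \<le> C1 * B"
    by (elim exE conjE) (rule that)
  from Cons.IH[OF Dp ls] obtain C2 where C2: "C2 \<ge> 0"
    "\<forall>v (L :: 'b \<Rightarrow> 'c) B z.
     linear L \<and> norm v \<le> B \<and> (\<forall>h. norm (L h) \<le> B * norm h) \<and> z \<in> K \<longrightarrow>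
     norm (iter_deriv (\<lambda>z. frechet_derivative \<phi> (at z) w *\<^sub>R (v + L z)) vs z) \<le> C2 * B"
    by (elim exE conjE) (rule that)
  have "norm (iter_deriv (\<lambda>z. \<phi> z *\<^sub>R (v + L z)) (w # vs) z) \<le> (C1 * norm w + C2) * B"
    if L: "linear L" "norm v \<le> B" "\<forall>h. norm (L h) \<le> B * norm h" "z \<in> K"
    for v z B and L :: "'b \<Rightarrow> 'c"
  proof -
    have bl: "bounded_linear L" using L(1) by (simp add: linear_conv_bounded_linear)
    have der: "((\<lambda>z. v + L z) has_derivative L) (at y)" for y
      using bounded_linear_imp_has_derivative[OF bl] by (auto intro!: derivative_eq_intros)
    \<comment> \<open>The summand 0 presents the constant L w as an affine map with linear part
      zero, to which the induction hypothesis applies with the bound B * |w|.\<close>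
    have "(\<lambda>y. frechet_derivative (\<lambda>z. \<phi> z *\<^sub>R (v + L z)) (at y) w) =
          (\<lambda>y. \<phi> y *\<^sub>R (L w + 0) + frechet_derivative \<phi> (at y) w *\<^sub>R (v + L y))"
      using frechet_derivative_eqI[OF bounded_bilinear.FDERIV[OF bounded_bilinear_scaleR
        has_derivative_frechet[OF dp] der]] by (intro ext) simp
    then have "iter_deriv (\<lambda>z. \<phi> z *\<^sub>R (v + L z)) (w # vs) z =
       iter_deriv (\<lambda>y. \<phi> y *\<^sub>R (L w + 0) + frechet_derivative \<phi> (at y) w *\<^sub>R (v + L y)) vs z" by simp
    also have "\<dots> = iter_deriv (\<lambda>y. \<phi> y *\<^sub>R (L w + 0)) vs z
        + iter_deriv (\<lambda>y. frechet_derivative \<phi> (at y) w *\<^sub>R (v + L y)) vs z"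
      by (rule iter_deriv_add[OF open_UNIV
            Cr_on_scaleR_affine[OF p linear_zero] Cr_on_scaleR_affine[OF Dp L(1)] UNIV_I ls])
    also have "norm \<dots> \<le> C1 * (B * norm w) + C2 * B"
    proof (rule norm_triangle_le, rule add_mono)
      have "B \<ge> 0" using L(2) norm_ge_zero order_trans by blast
      then show "norm (iter_deriv (\<lambda>y. \<phi> y *\<^sub>R (L w + 0)) vs z) \<le> C1 * (B * norm w)"
        using L by (intro C1(2)[rule_format]) (auto simp: linear_zero)
      show "norm (iter_deriv (\<lambda>y. frechet_derivative \<phi> (at y) w *\<^sub>R (v + L y)) vs z) \<le> C2 * B"
        using L by (intro C2(2)[rule_format]) auto
    qed
    also have "\<dots> = (C1 * norm w + C2) * B" by (simp add: algebra_simps)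
    finally show ?thesis .
  qed
  moreover have "C1 * norm w + C2 \<ge> 0" using C1(1) C2(1) by simp
  ultimately show ?case by blast
qed

text \<open>An exponent of at least 2 makes the kink at 0 differentiable: there the difference
  quotient is \<open>max 0 h ^ (n + 1)\<close>, which tends to 0.\<close>

lemma has_real_derivative_max_power:
  "((\<lambda>t::real. max 0 t ^ (n + 2)) has_real_derivative real (n + 2) * max 0 t ^ (n + 1)) (at t)"
proof -
  consider "t > 0" | "t < 0" | "t = 0" by linarith
  then show ?thesis
  proof cases
    case 1
    have "((\<lambda>t::real. t ^ (n + 2)) has_real_derivative real (n + 2) * t ^ (n + 1)) (at t)"
      using DERIV_pow[of "n + 2" t] by simp
    then have "((\<lambda>t::real. max 0 t ^ (n + 2)) has_real_derivative real (n + 2) * t ^ (n + 1)) (at t)"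
      by (rule has_field_derivative_transform_within_open[where S = "{0<..}"]) (use 1 in auto)
    then show ?thesis using 1 by (simp add: max_def)
  next
    case 2
    have "((\<lambda>t::real. max 0 t ^ (n + 2)) has_real_derivative 0) (at t)"
      by (rule has_field_derivative_transform_within_open[where S = "{..<0}" and f = "\<lambda>_. 0"])
         (use 2 in auto)
    then show ?thesis using 2 by (simp add: max_def)
  next
    case 3
    have "((\<lambda>h::real. max 0 h ^ (n + 1)) \<longlongrightarrow> max 0 0 ^ (n + 1)) (at 0)"
      by (intro tendsto_intros)
    moreover have "max 0 h ^ (n + 1) = max 0 h ^ (n + 2) / h" if "h \<noteq> 0" for h :: real
      using that by (simp add: max_def)
    ultimately have "((\<lambda>h::real. max 0 h ^ (n + 2) / h) \<longlongrightarrow> 0) (at 0)"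
      using tendsto_cong[of "\<lambda>h::real. max 0 h ^ (n + 1)" "\<lambda>h. max 0 h ^ (n + 2) / h" "at 0" 0]
      by (simp add: eventually_at_filter)
    then show ?thesis using 3 by (simp add: DERIV_def)
  qed
qed

text \<open>A bump of finite class is enough, so a power replaces the usual exp(- 1 / t). Every
  differentiation lowers the exponent by one, and exponent m + 1 leaves a continuous function after
  m of them. The bump is 1 with derivative 0 at the origin and vanishes outside the unit
  ball.\<close>

lemma Cr_on_bump:
  shows "Cr_on m (\<lambda>z::'b::euclidean_space. max 0 (1 - z \<bullet> z) ^ (m + 1)) UNIV"
    and "((\<lambda>z::'b. max 0 (1 - z \<bullet> z) ^ (m + 2)) has_derivative
      (\<lambda>w. (- 2 * (z \<bullet> w)) * (real (m + 2) * max 0 (1 - z \<bullet> z) ^ (m + 1)))) (at z)"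
proof -
  show der: "((\<lambda>z::'b. max 0 (1 - z \<bullet> z) ^ (m + 2)) has_derivative
      (\<lambda>w. (- 2 * (z \<bullet> w)) * (real (m + 2) * max 0 (1 - z \<bullet> z) ^ (m + 1)))) (at z)" for m z
  proof -
    have "((\<lambda>z::'b. 1 - z \<bullet> z) has_derivative (\<lambda>w. - 2 * (z \<bullet> w))) (at z)"
      by (auto intro!: derivative_eq_intros simp: inner_commute)
    from has_derivative_compose[OF this
        has_real_derivative_max_power[unfolded has_field_derivative_def, of m "1 - z \<bullet> z"]]
    show ?thesis by (simp add: mult_ac)
  qed
  show "Cr_on m (\<lambda>z::'b. max 0 (1 - z \<bullet> z) ^ (m + 1)) UNIV"
  proof (induction m)
    case 0
    show ?case by (auto simp: Cr_on_0 intro!: continuous_intros)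
  next
    case (Suc m)
    have "Cr_on m (\<lambda>z. frechet_derivative (\<lambda>z::'b. max 0 (1 - z \<bullet> z) ^ (Suc m + 1)) (at z) w) UNIV" for w
    proof -
      have "Cr_on m (\<lambda>z. (- 2 * (z \<bullet> w)) * (real (m + 2) * max 0 (1 - z \<bullet> z) ^ (m + 1))) UNIV"
        by (intro Cr_on_bilinear[OF bounded_bilinear_mult] Cr_on_const Suc Cr_on_bounded_linear
              open_UNIV bounded_linear_inner_left)
      also have "(\<lambda>z. (- 2 * (z \<bullet> w)) * (real (m + 2) * max 0 (1 - z \<bullet> z) ^ (m + 1))) =
         (\<lambda>z. frechet_derivative (\<lambda>z::'b. max 0 (1 - z \<bullet> z) ^ (Suc m + 1)) (at z) w)"
        using frechet_derivative_eqI[OF der] by auto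
      finally show ?thesis .
    qed
    moreover have "(\<lambda>z::'b. max 0 (1 - z \<bullet> z) ^ (Suc m + 1)) differentiable (at x)" for x
      using der[of m x] by (auto simp: differentiable_def)
    moreover have "continuous_on UNIV (\<lambda>z::'b. max 0 (1 - z \<bullet> z) ^ (Suc m + 1))"
      by (auto intro!: continuous_intros)
    ultimately show ?case unfolding Cr_on_Suc by blast
  qed
qed

text \<open>
  The germ is a sum of bumps times affine maps, supported in the balls of radius |x n| / 4 around
  the x n. These are disjoint, and differentiating such a summand s times costs only a factor
  |x n| ^ (-s), so the growth assumptions make the r-jet of the sum vanish at 0.
\<close>

lemma flat_germ_interpolation:
  fixes x :: "nat \<Rightarrow> 'b::euclidean_space" and v :: "nat \<Rightarrow> 'c::real_inner"
  assumes x0: "\<And>n. x n \<noteq> 0" and half: "\<And>n. norm (x (Suc n)) \<le> norm (x n) / 2"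
    and lin: "\<And>n. linear (L n)" and eps: "\<epsilon> \<longlonglongrightarrow> 0"
    and v: "\<And>n. norm (v n) \<le> \<epsilon> n * norm (x n) ^ r"
    and L: "\<And>n h. norm (x n) * norm (L n h) \<le> \<epsilon> n * norm (x n) ^ r * norm h"
  obtains h where "flat_germ r h" "\<And>n. h (x n) = v n" "\<And>n. (h has_derivative L n) (at (x n))"
proof -
  \<comment> \<open>Points of the n-th ball have norm between 3/4 and 5/4 of |x n|. For i < j the
    halving gives 5/4 * |x j| <= 5/8 * |x i| < 3/4 * |x i|, so even the closed balls are
    disjoint.\<close>
  define \<rho> where "\<rho> n = norm (x n) / 4" for n
  \<comment> \<open>Exponent r + 2 makes \<phi> of class C^(r+1), the order asked for by
    \<open>flat_germI\<close>. As \<phi> is 1 with derivative 0 at the origin,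
    \<open>\<psi> n\<close> has there the 1-jet of its affine factor; the factor
    \<open>\<rho> n\<close> in it undoes the rescaling of the variable in
    \<open>b n\<close>.\<close>
  define \<phi> where "\<phi> z = max 0 (1 - z \<bullet> z) ^ (r + 2)" for z :: 'b
  define \<psi> where "\<psi> n z = \<phi> z *\<^sub>R (v n + \<rho> n *\<^sub>R L n z)" for n z
  define b where "b n y = \<psi> n ((y - x n) /\<^sub>R \<rho> n)" for n y
  define B where "B n = \<epsilon> n * norm (x n) ^ r" for n
  define h where "h y = (\<Sum>n. b n y)" for y
  have \<rho>: "\<rho> n > 0" for n using x0 by (simp add: \<rho>_def)
  have \<phi>: "Cr_on (Suc r) \<phi> UNIV"
    using Cr_on_bump(1)[where m = "Suc r" and 'b = 'b] unfolding \<phi>_def by simp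
  have d\<phi>: "(\<phi> has_derivative (\<lambda>_. 0)) (at 0)"
    using Cr_on_bump(2)[of r 0] unfolding \<phi>_def by simp
  have linL: "linear (\<lambda>z. \<rho> n *\<^sub>R L n z)" for n
    by (rule linear_compose_scale_right[OF lin])
  have \<psi>: "Cr_on (Suc r) (\<psi> n) UNIV" for n
    unfolding \<psi>_def using Cr_on_scaleR_affine[OF \<phi> linL] .
  have b: "Cr_on (Suc r) (b n) UNIV" for n
    using Cr_on_affine_scaling(1)[OF \<psi>[of n], where \<rho> = "\<rho> n" and c = 1 and a = "x n"] \<rho>[of n] unfolding b_def by simp
  have norm_scaled: "norm ((y - x n) /\<^sub>R \<rho> n) = norm (y - x n) / \<rho> n" for y n
    using \<rho>[of n] by (simp add: divide_inverse)
  have b_outside: "b n y = 0" if "\<rho> n \<le> norm (y - x n)" for n y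
  proof -
    have "1 \<le> norm ((y - x n) /\<^sub>R \<rho> n)" using that \<rho>[of n] by (simp add: norm_scaled del: norm_scaleR)
    then have "1 \<le> (norm ((y - x n) /\<^sub>R \<rho> n))\<^sup>2" by simp
    then show ?thesis unfolding b_def \<psi>_def \<phi>_def power2_norm_eq_inner by simp
  qed
  have decay: "norm (x (m + k)) \<le> norm (x m) / 2 ^ k" for m k
  proof (induction k)
    case (Suc k)
    then have "norm (x (m + k)) / 2 \<le> norm (x m) / 2 ^ k / 2" by (rule divide_right_mono) simp
    then show ?case using half[of "m + k"] by (simp add: mult.commute)
  qed simp
  have decr: "norm (x n) \<le> norm (x m)" if "m \<le> n" for m n
  proof -
    have "norm (x m) / 2 ^ (n - m) \<le> norm (x m) / 1"
      by (intro divide_left_mono) auto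
    then show ?thesis using decay[of m "n - m"] that by simp
  qed
  have half': "norm (x n) \<le> norm (x m) / 2" if "m < n" for m n
    using decr[of "Suc m" n] half[of m] that by simp
  have "(\<lambda>n. norm (x 0) / 2 ^ n) \<longlonglongrightarrow> 0" by real_asymp
  then have lim_x: "(\<lambda>n. norm (x n)) \<longlonglongrightarrow> 0"
    by (rule Lim_null_comparison[rotated]) (use decay[of 0] in auto)
  have near: "norm y \<le> 5/4 * norm (x n) \<and> 3/4 * norm (x n) \<le> norm y"
    if "norm (y - x n) \<le> \<rho> n" for y n
    using that norm_triangle_ineq2[of y "x n"] norm_triangle_ineq2[of "x n" y]
    by (simp add: \<rho>_def norm_minus_commute)
  have disj: "m = n" if "norm (y - x m) \<le> \<rho> m" "norm (y - x n) \<le> \<rho> n" for m n y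
  proof -
    have "\<not> i < j" if "norm (y - x i) \<le> \<rho> i" "norm (y - x j) \<le> \<rho> j" for i j
    proof
      assume "i < j"
      then have "norm (x j) \<le> norm (x i) / 2" by (rule half')
      moreover have "0 < norm (x i)" using x0 by simp
      ultimately show False
        using near[OF that(1), THEN conjunct2] near[OF that(2), THEN conjunct1] by linarith
    qed
    then show ?thesis using that by (metis nat_neq_iff)
  qed
  \<comment> \<open>Only finitely many balls come near y: those with n >= N lie in the region |z| <
    |y| / 2, and each of the remaining ones that misses y also misses a neighbourhood of y, because
    it is closed.\<close>
  have locfin: "\<forall>\<^sub>F z in nhds y. \<forall>n. \<rho> n < norm (y - x n) \<longrightarrow> b n z = 0" if "y \<noteq> 0" for y
  proof -
    have "\<forall>\<^sub>F n in sequentially. norm (x n) < norm y / 4"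
      using order_tendstoD(2)[OF lim_x, of "norm y / 4"] that by simp
    then obtain N where N: "\<And>n. n \<ge> N \<Longrightarrow> norm (x n) < norm y / 4"
      by (auto simp: eventually_sequentially)
    have "\<forall>\<^sub>F z in nhds y. \<forall>n\<in>{..<N}. \<rho> n < norm (y - x n) \<longrightarrow> b n z = 0"
    proof (intro eventually_ball_finite ballI)
      fix n
      show "\<forall>\<^sub>F z in nhds y. \<rho> n < norm (y - x n) \<longrightarrow> b n z = 0"
      proof (cases "\<rho> n < norm (y - x n)")
        case True
        have "open {z. \<rho> n < norm (z - x n)}" by (intro open_Collect_less continuous_intros)
        then have "\<forall>\<^sub>F z in nhds y. \<rho> n < norm (z - x n)"
          using True eventually_nhds_in_open[of "{z. \<rho> n < norm (z - x n)}" y] by simp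
        then show ?thesis by eventually_elim (simp add: b_outside)
      qed simp
    qed simp
    moreover have "\<forall>\<^sub>F z in nhds y. norm y / 2 < norm z"
    proof -
      have "open {z. norm y / 2 < norm z}" by (intro open_Collect_less continuous_intros)
      then show ?thesis
        using that eventually_nhds_in_open[of "{z. norm y / 2 < norm z}" y] by simp
    qed
    ultimately show ?thesis
    proof eventually_elim
      case (elim z)
      have "b n z = 0" if "N \<le> n" for n
        using N[OF that] elim(2) norm_triangle_ineq2[of z "x n"] norm_ge_zero[of "x n"]
        by (intro b_outside) (simp add: \<rho>_def del: norm_ge_zero)
      then show ?case using elim(1) by (metis lessThan_iff not_le)
    qed
  qed
  \<comment> \<open>This includes y on the boundary of the n-th ball: such a y is still strictly
    outside all the other balls.\<close>
  have h_near: "\<forall>\<^sub>F z in nhds y. h z = b n z" if y: "norm (y - x n) \<le> \<rho> n" for y n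
  proof -
    have "y \<noteq> 0" using near[OF y] x0[of n] by auto
    from locfin[OF this] show ?thesis
    proof eventually_elim
      case (elim z)
      have "b m z = 0" if "m \<noteq> n" for m using disj[OF _ y] that elim by (meson not_le)
      then show ?case unfolding h_def using suminf_finite[of "{n}" "\<lambda>m. b m z"] by simp
    qed
  qed
  have h_far: "\<forall>\<^sub>F z in nhds y. h z = 0" if "y \<noteq> 0" "\<And>n. \<rho> n < norm (y - x n)" for y
    using locfin[OF that(1)] by eventually_elim (use that(2) in \<open>simp add: h_def\<close>)
  have Crh: "Cr_on (Suc r) h (- {0})"
  proof (rule Cr_on_local)
    fix y :: 'b assume y: "y \<in> - {0}"
    obtain g where g: "\<forall>\<^sub>F z in nhds y. h z = g z" "Cr_on (Suc r) g UNIV"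
    proof (cases "\<exists>n. norm (y - x n) \<le> \<rho> n")
      case True
      then show ?thesis using that h_near b by blast
    next
      case False
      then have "\<forall>\<^sub>F z in nhds y. h z = 0" using h_far[of y] y by (simp add: not_le)
      then show ?thesis by (rule that[OF _ Cr_on_const])
    qed
    then obtain N where N: "open N" "y \<in> N" "\<And>z. z \<in> N \<Longrightarrow> g z = h z"
      by (auto simp: eventually_nhds)
    then show "\<exists>N. open N \<and> y \<in> N \<and> Cr_on (Suc r) h N"
      using Cr_on_cong[OF N(1,3) Cr_on_mono[OF g(2) order.refl]] by blast
  qed
  have small: "\<forall>\<^sub>F y in at 0. norm y ^ length vs * norm (iter_deriv h vs y) \<le> e * norm y ^ r"
    if len: "length vs \<le> Suc r" and "e > 0" for vs e
  proof -
    from iter_deriv_mult_affine_bound[OF \<phi> compact_cball[of 0 1] len]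
    obtain C where C: "C \<ge> 0" "\<forall>w (\<Lambda> :: 'b \<Rightarrow> 'c) B z.
       linear \<Lambda> \<and> norm w \<le> B \<and> (\<forall>h. norm (\<Lambda> h) \<le> B * norm h) \<and> z \<in> cball 0 1 \<longrightarrow>
       norm (iter_deriv (\<lambda>z. \<phi> z *\<^sub>R (w + \<Lambda> z)) vs z) \<le> C * B"
      by (elim exE conjE) (rule that)
    \<comment> \<open>5 comes from |y| <= 5 * \<rho> n and 2 from |x n| <= 2 * |y|, for y in the
      n-th ball; the summand 1 makes K positive even if C = 0.\<close>
    define K where "K = 5 ^ length vs * 2 ^ r * C + 1"
    have K: "K > 0" using C(1) by (auto simp: K_def intro: add_nonneg_pos)
    have "\<forall>\<^sub>F n in sequentially. \<epsilon> n < e / K"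
      using order_tendstoD(2)[OF eps, of "e / K"] \<open>e > 0\<close> K by simp
    then obtain N where N: "\<And>n. n \<ge> N \<Longrightarrow> \<epsilon> n < e / K"
      by (auto simp: eventually_sequentially)
    have est: "norm y ^ length vs * norm (iter_deriv h vs y) \<le> e * norm y ^ r"
      if y: "y \<noteq> 0" "norm y < norm (x N) / 2" for y
    proof (cases "\<exists>n. norm (y - x n) \<le> \<rho> n")
      case False
      then have "\<forall>\<^sub>F z in nhds y. h z = 0" using h_far y(1) by (meson not_le)
      then obtain N where "open N" "y \<in> N" "\<And>z. z \<in> N \<Longrightarrow> h z = 0" by (auto simp: eventually_nhds)
      then have "iter_deriv h vs y = 0" using iter_deriv_cong_open[of N h "\<lambda>_. 0" y vs] by simp
      then show ?thesis using \<open>e > 0\<close> by simp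
    next
      case True
      then obtain n where n: "norm (y - x n) \<le> \<rho> n" by blast
      \<comment> \<open>For n < N the points of the n-th ball have norm at least 3/4 * |x N|, too
        large for y.\<close>
      have "\<not> n < N" using near[OF n] y(2) decr[of n N] by auto
      then have en: "\<epsilon> n \<le> e / K" using N[of n] by simp
      have B0: "B n \<ge> 0" unfolding B_def using v norm_ge_zero order_trans by blast
      have "norm (x n) ^ r > 0" using x0 by simp
      then have e0: "\<epsilon> n \<ge> 0" using B0 unfolding B_def zero_le_mult_iff by linarith
      obtain M where M: "open M" "y \<in> M" "\<And>z. z \<in> M \<Longrightarrow> h z = b n z"
        using h_near[OF n] by (auto simp: eventually_nhds)
      have "iter_deriv h vs y = iter_deriv (b n) vs y"
        using iter_deriv_cong_open[OF M(1,3,2)] by simp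
      also have "\<dots> = (1 / \<rho> n ^ length vs) *\<^sub>R iter_deriv (\<psi> n) vs ((y - x n) /\<^sub>R \<rho> n)"
        using Cr_on_affine_scaling(2)[OF \<psi>[of n] _ len, where \<rho> = "\<rho> n" and c = 1 and a = "x n" and x = y] \<rho>[of n]
        unfolding b_def by simp
      finally have eq: "\<rho> n ^ length vs * norm (iter_deriv h vs y)
          = norm (iter_deriv (\<psi> n) vs ((y - x n) /\<^sub>R \<rho> n))"
        using \<rho>[of n] by simp
      also have "\<dots> \<le> C * B n"
        unfolding \<psi>_def
      proof (rule C(2)[rule_format], intro conjI allI)
        show "norm (v n) \<le> B n" using v by (simp add: B_def)
        show "(y - x n) /\<^sub>R \<rho> n \<in> cball 0 1" using n \<rho>[of n] by (simp add: norm_scaled del: norm_scaleR)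
        show "norm (\<rho> n *\<^sub>R L n k) \<le> B n * norm k" for k
        proof -
          have "norm (\<rho> n *\<^sub>R L n k) = norm (x n) * norm (L n k) / 4" by (simp add: \<rho>_def)
          also have "\<dots> \<le> norm (x n) * norm (L n k)" by simp
          finally show ?thesis using L[of n k] by (simp add: B_def)
        qed
      qed (rule linL)
      finally have bd: "\<rho> n ^ length vs * norm (iter_deriv h vs y) \<le> C * B n" .
      have "norm y ^ length vs \<le> (5 * \<rho> n) ^ length vs"
        using near[OF n] by (intro power_mono) (auto simp: \<rho>_def)
      then have "norm y ^ length vs * norm (iter_deriv h vs y)
          \<le> 5 ^ length vs * (\<rho> n ^ length vs * norm (iter_deriv h vs y))"
        using mult_right_mono[of "norm y ^ length vs" "(5 * \<rho> n) ^ length vs" "norm (iter_deriv h vs y)"]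
        by (simp add: power_mult_distrib mult.assoc)
      also have "\<dots> \<le> 5 ^ length vs * (C * B n)" using bd by simp
      also have "\<dots> \<le> 5 ^ length vs * (C * (\<epsilon> n * (2 ^ r * norm y ^ r)))"
      proof -
        have "norm (x n) ^ r \<le> (2 * norm y) ^ r"
          using near[OF n] by (intro power_mono) auto
        then have "B n \<le> \<epsilon> n * (2 ^ r * norm y ^ r)"
          unfolding B_def using e0 by (simp add: mult_left_mono power_mult_distrib)
        then show ?thesis using C(1) by (simp add: mult_left_mono)
      qed
      also have "\<dots> = (K - 1) * \<epsilon> n * norm y ^ r" by (simp add: K_def)
      also have "\<dots> \<le> K * (e / K) * norm y ^ r"
        using en e0 K C(1) by (intro mult_right_mono mult_mono) (auto simp: K_def)
      also have "\<dots> = e * norm y ^ r" using K by simp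
      finally show ?thesis .
    qed
    show ?thesis
      unfolding eventually_at using est x0[of N]
      by (intro exI[of _ "norm (x N) / 2"]) auto
  qed
  have h0: "h 0 = 0"
    unfolding h_def by (simp add: b_outside \<rho>_def)
  have "flat_germ r h" using flat_germI[OF Crh h0 small] .
  moreover have "h (x n) = v n" for n
  proof -
    have "h (x n) = b n (x n)"
      using h_near[of "x n" n] \<rho>[of n] eventually_nhds_x_imp_x by fastforce
    then show ?thesis using linear_0[OF lin] by (simp add: b_def \<psi>_def \<phi>_def)
  qed
  moreover have "(h has_derivative L n) (at (x n))" for n
  proof -
    obtain M where M: "open M" "x n \<in> M" "\<And>z. z \<in> M \<Longrightarrow> b n z = h z"
      using h_near[of "x n" n] \<rho>[of n] by (auto simp: eventually_nhds)
    have bl: "bounded_linear (L n)" using lin by (simp add: linear_conv_bounded_linear)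
    have "((\<lambda>z. v n + \<rho> n *\<^sub>R L n z) has_derivative (\<lambda>z. \<rho> n *\<^sub>R L n z)) (at 0)"
      using bounded_linear_imp_has_derivative[OF bl] by (auto intro!: derivative_eq_intros)
    from bounded_bilinear.FDERIV[OF bounded_bilinear_scaleR d\<phi> this]
    have "(\<psi> n has_derivative (\<lambda>z. \<rho> n *\<^sub>R L n z)) (at ((x n - x n) /\<^sub>R \<rho> n))"
      unfolding \<psi>_def by (simp add: \<phi>_def)
    note chain = has_derivative_compose[where f = "\<lambda>y. (y - x n) /\<^sub>R \<rho> n" and g = "\<psi> n", OF _ this]
    have "((\<lambda>y. (y - x n) /\<^sub>R \<rho> n) has_derivative (\<lambda>y. y /\<^sub>R \<rho> n)) (at (x n))"
      by (auto intro!: derivative_eq_intros)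
    from chain[OF this]
    have "((\<lambda>y. \<psi> n ((y - x n) /\<^sub>R \<rho> n)) has_derivative (\<lambda>y. \<rho> n *\<^sub>R L n (y /\<^sub>R \<rho> n))) (at (x n))" .
    moreover have "\<rho> n *\<^sub>R L n (y /\<^sub>R \<rho> n) = L n y" for y
      using \<rho>[of n] linear_scale[OF lin] by simp
    ultimately have "(b n has_derivative L n) (at (x n))" unfolding b_def by simp
    then show ?thesis by (rule has_derivative_transform_within_open[OF _ M])
  qed
  ultimately show thesis using that by blast
qed

section \<open>The conditions t^r in terms of 1-jets\<close>

definition smooth_map :: "('b::euclidean_space \<Rightarrow> 'c::real_normed_vector) \<Rightarrow> bool" where
  "smooth_map f \<longleftrightarrow> (\<forall>m. Cr_on m f UNIV)"

lemma smooth_map_differentiable: "smooth_map f \<Longrightarrow> f differentiable (at x)"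
  unfolding smooth_map_def using Cr_on_Suc[of 0 f UNIV] by blast

lemma smooth_map_uminus: "smooth_map f \<Longrightarrow> smooth_map (\<lambda>x. - f x)"
  unfolding smooth_map_def
  using Cr_on_compose_bounded_linear[OF bounded_linear_minus[OF bounded_linear_ident] open_UNIV] by blast

section \<open>Adding a smooth map, which reduces the r-jet of f to the zero jet\<close>

lemma Cr_germ_differentiable:
  assumes "Cr_germ r g"
  shows "\<forall>\<^sub>F x in at 0. g differentiable (at x)"
proof -
  obtain U where U: "open U" "0 \<in> U" "Cr_on 1 g (U - {0})"
    using assms Cr_on_mono[of r g _ 1] unfolding Cr_germ_def
    by (metis Diff_subset One_nat_def Suc_leI bot_nat_0.not_eq_extremum)
  then have "\<forall>\<^sub>F x in at 0. x \<in> U - {0}" using eventually_at_in_open by blast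
  then show ?thesis by eventually_elim (use U(3) in \<open>simp add: Cr_on_Suc\<close>)
qed

lemma smooth_map_onorm_derivative:
  fixes f :: "'b::euclidean_space \<Rightarrow> 'c::real_normed_vector"
  assumes "smooth_map f"
  shows "(\<lambda>x. onorm (frechet_derivative f (at x))) \<in> O[at 0](\<lambda>x. 1 / norm x)"
proof (rule landau_o.small_imp_big, rule frechet_derivative_smallo_inverse)
  fix b :: 'b and e :: real assume "e > 0"
  have "isCont (\<lambda>y. frechet_derivative f (at y) b) 0"
    using assms Cr_on_Suc[of 0 f UNIV] unfolding smooth_map_def Cr_on_0
    by (metis UNIV_I continuous_on_eq_continuous_at open_UNIV)
  then have "((\<lambda>y. norm y * norm (frechet_derivative f (at y) b)) \<longlongrightarrow>
      norm (0::'b) * norm (frechet_derivative f (at 0) b)) (at 0)"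
    unfolding isCont_def by (intro tendsto_intros)
  then have "\<forall>\<^sub>F y in at 0. norm y * norm (frechet_derivative f (at y) b) < e"
    using \<open>e > 0\<close> by (intro order_tendstoD(2)) auto
  then show "\<forall>\<^sub>F y in at 0. norm y * norm (frechet_derivative f (at y) b) \<le> e"
    by eventually_elim simp
qed (use assms smooth_map_differentiable in blast)

text \<open>The case r = 0 is separate because C^{0,-1} is not an instance of \<open>Cr_on\<close>;
  its O(1 / |x|) bound survives since |x| times the derivative of a smooth map tends to 0.\<close>

lemma Cr_germ_add_smooth:
  assumes g: "Cr_germ r g" and f: "smooth_map f" "f 0 = 0"
  shows "Cr_germ r (\<lambda>x. g x + f x)"
proof -
  obtain U where U: "open U" "0 \<in> U" and C: "if r = 0
      then continuous_on U g \<and> Cr_on 1 g (U - {0}) \<and>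
           (\<lambda>x. onorm (frechet_derivative g (at x))) \<in> O[at 0](\<lambda>x. 1 / norm x)
      else Cr_on r g U"
    using g unfolding Cr_germ_def by blast
  have fC: "Cr_on m f V" for m V
    using f(1) Cr_on_mono[of m f UNIV m V] by (simp add: smooth_map_def)
  show ?thesis
  proof (cases "r = 0")
    case False
    then show ?thesis
      using C U f(2) g Cr_on_add[OF U(1) _ fC] unfolding Cr_germ_def by auto
  next
    case True
    have "(\<lambda>x. onorm (frechet_derivative (\<lambda>x. g x + f x) (at x))) \<in> O[at 0](\<lambda>x. 1 / norm x)"
    proof (rule landau_o.big_trans)
      show "(\<lambda>x. onorm (frechet_derivative g (at x)) + onorm (frechet_derivative f (at x)))
              \<in> O[at 0](\<lambda>x. 1 / norm x)"
        using C True smooth_map_onorm_derivative[OF f(1)] by (intro sum_in_bigo) auto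
      have "\<forall>\<^sub>F x in at 0. norm (onorm (frechet_derivative (\<lambda>x. g x + f x) (at x))) \<le>
        norm (onorm (frechet_derivative g (at x)) + onorm (frechet_derivative f (at x)))"
        using Cr_germ_differentiable[OF g]
      proof eventually_elim
        case (elim x)
        note D = has_derivative_frechet[OF elim]
          has_derivative_frechet[OF smooth_map_differentiable[OF f(1), of x]]
        have "frechet_derivative (\<lambda>x. g x + f x) (at x) =
            (\<lambda>h. frechet_derivative g (at x) h + frechet_derivative f (at x) h)"
          using frechet_derivative_at[OF has_derivative_add[OF D]] by simp
        then show ?case
          using order_trans[OF onorm_triangle[OF D[THEN has_derivative_bounded_linear]] abs_ge_self]
            onorm_pos_le[OF has_derivative_bounded_linear[OF has_derivative_add[OF D]]] by simp
      qed
      then show "(\<lambda>x. onorm (frechet_derivative (\<lambda>x. g x + f x) (at x))) \<in>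
        O[at 0](\<lambda>x. onorm (frechet_derivative g (at x)) + onorm (frechet_derivative f (at x)))"
        by (rule landau_o.big_mono)
    qed
    moreover have "continuous_on U (\<lambda>x. g x + f x)"
      using C True Cr_on_imp_continuous_on[OF fC] by (auto intro: continuous_on_add)
    moreover have "Cr_on 1 (\<lambda>x. g x + f x) (U - {0})"
      using C True Cr_on_add[OF open_delete[OF U(1)] _ fC] by simp
    ultimately show ?thesis
      using True U f(2) g unfolding Cr_germ_def by auto
  qed
qed

lemma jet_equiv_add_smooth:
  assumes g: "Cr_germ r g" and f: "smooth_map f" and k: "smooth_map k" and j: "jet_equiv r f g"
  shows "jet_equiv r (\<lambda>x. f x + k x) (\<lambda>x. g x + k x)"
proof (cases "r = 0")
  case True
  \<comment> \<open>The equality holds only near 0, because additivity of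
    \<open>frechet_derivative\<close> needs g to be differentiable.\<close>
  have "\<forall>\<^sub>F x in at 0.
     onorm (\<lambda>h. frechet_derivative (\<lambda>x. f x + k x) (at x) h - frechet_derivative (\<lambda>x. g x + k x) (at x) h)
     = onorm (\<lambda>h. frechet_derivative f (at x) h - frechet_derivative g (at x) h)"
    using Cr_germ_differentiable[OF g]
  proof eventually_elim
    case (elim x)
    note k = has_derivative_frechet[OF smooth_map_differentiable[OF k]]
    show ?case
      using frechet_derivative_eqI[OF has_derivative_add[OF has_derivative_frechet[OF elim] k]]
        frechet_derivative_eqI[OF has_derivative_add[OF
          has_derivative_frechet[OF smooth_map_differentiable[OF f]] k]] by simp
  qed
  from landau_o.small.in_cong[OF this] show ?thesis using j True unfolding jet_equiv_def by simp
next
  case False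
  then obtain U where U: "open U" "0 \<in> U" "Cr_on r g U" using g unfolding Cr_germ_def by auto
  have C: "Cr_on r f U" "Cr_on r k U"
    using f k Cr_on_mono[of r _ UNIV r U] by (auto simp: smooth_map_def)
  show ?thesis
    using j False iter_deriv_add[OF U(1) C U(2)] iter_deriv_add[OF U(1,3) C(2) U(2)]
    unfolding jet_equiv_def by simp
qed

lemma flat_germ_imp_jet:
  assumes "flat_germ r h" "smooth_map f" "f 0 = 0"
  shows "Cr_germ r (\<lambda>x. f x + h x)" "jet_equiv r f (\<lambda>x. f x + h x)"
proof -
  have "smooth_map (\<lambda>_. 0)" by (simp add: smooth_map_def Cr_on_const)
  with assms show "Cr_germ r (\<lambda>x. f x + h x)" "jet_equiv r f (\<lambda>x. f x + h x)"
    using Cr_germ_add_smooth[of r h f] jet_equiv_add_smooth[of r h "\<lambda>_. 0" f]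
    unfolding flat_germ_def by (simp_all add: add.commute)
qed

lemma jet_imp_flat_germ:
  assumes "Cr_germ r g" "jet_equiv r f g" "smooth_map f" "f 0 = 0"
  shows "flat_germ r (\<lambda>x. g x - f x)"
  using assms Cr_germ_add_smooth[OF assms(1) smooth_map_uminus[OF assms(3)]]
    jet_equiv_add_smooth[OF assms(1,3) smooth_map_uminus[OF assms(3)] assms(2)]
  unfolding flat_germ_def by simp

text \<open>Taylor's estimate by induction on r instead of a remainder formula: the directional
  derivatives have vanishing jet of order one less, hence are small by induction, and the mean value
  inequality gains one power of |x|.\<close>

lemma Cr_on_zero_jet_small:
  fixes h :: "'b::euclidean_space \<Rightarrow> 'c::real_inner"
  assumes "open U" "0 \<in> U" "Cr_on r h U" "\<And>vs. length vs \<le> r \<Longrightarrow> iter_deriv h vs 0 = 0" "e > 0"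
  shows "\<forall>\<^sub>F x in nhds 0. norm (h x) \<le> e * norm x ^ r"
    and "r = Suc s \<Longrightarrow> \<forall>\<^sub>F x in nhds 0. \<forall>v. norm (frechet_derivative h (at x) v) \<le> e * norm x ^ s * norm v"
proof -
  \<comment> \<open>The induction hypothesis is a premise here, since the argument serves inside the
    induction and once more, afterwards, for the second claim.\<close>
  have step: "\<forall>\<^sub>F x in nhds 0. \<forall>v. norm (frechet_derivative h (at x) v) \<le> e * norm x ^ s * norm v"
    if IH: "\<And>(k :: 'b \<Rightarrow> 'c) e. Cr_on s k U \<Longrightarrow> (\<And>vs. length vs \<le> s \<Longrightarrow> iter_deriv k vs 0 = 0) \<Longrightarrow> e > 0
        \<Longrightarrow> \<forall>\<^sub>F x in nhds 0. norm (k x) \<le> e * norm x ^ s"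
      and h: "Cr_on (Suc s) h U" "\<And>vs. length vs \<le> Suc s \<Longrightarrow> iter_deriv h vs 0 = 0" "e > 0"
    for s e and h :: "'b \<Rightarrow> 'c"
  proof -
    have "\<forall>\<^sub>F x in nhds 0. \<forall>b\<in>Basis. norm (frechet_derivative h (at x) b) \<le> e / DIM('b) * norm x ^ s"
    proof (intro eventually_ball_finite ballI IH)
      fix b :: 'b and vs :: "'b list"
      show "Cr_on s (\<lambda>x. frechet_derivative h (at x) b) U" using h(1) by (simp add: Cr_on_Suc)
      show "iter_deriv (\<lambda>x. frechet_derivative h (at x) b) vs 0 = 0" if "length vs \<le> s"
        using h(2)[of "b # vs"] that by simp
    qed (use \<open>e > 0\<close> in auto)
    moreover have "\<forall>\<^sub>F x in nhds 0. x \<in> U" using assms(1,2) eventually_nhds_in_open by blast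
    ultimately show ?thesis
    proof eventually_elim
      case (elim x)
      have "linear (frechet_derivative h (at x))"
        using h(1) elim(2) by (simp add: Cr_on_Suc linear_frechet_derivative)
      note lin = linear_norm_le_sum_Basis[OF this]
      have "(\<Sum>b\<in>Basis. norm (frechet_derivative h (at x) b))
          \<le> (\<Sum>b\<in>(Basis::'b set). e / DIM('b) * norm x ^ s)"
        using elim(1) by (intro sum_mono) auto
      also have "\<dots> = e * norm x ^ s" by simp
      finally show ?case
        by (intro allI order_trans[OF lin] mult_right_mono) auto
    qed
  qed
  have main: "\<forall>\<^sub>F x in nhds 0. norm (h x) \<le> e * norm x ^ r"
    if "Cr_on r h U" "\<And>vs. length vs \<le> r \<Longrightarrow> iter_deriv h vs 0 = 0" "e > 0" for r e and h :: "'b \<Rightarrow> 'c"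
    using that
  proof (induction r arbitrary: h e)
    case 0
    then have "isCont h 0" using assms(1,2) by (simp add: Cr_on_0 continuous_on_eq_continuous_at)
    then have "\<forall>\<^sub>F x in nhds 0. norm (h x - h 0) < e"
      using \<open>0 < e\<close> unfolding continuous_at_eps_delta eventually_nhds_metric by (auto simp: dist_norm)
    then show ?case using 0(2)[of "[]"] by (auto elim: eventually_mono)
  next
    case (Suc s)
    have "\<forall>\<^sub>F x in nhds 0. \<forall>v. norm (frechet_derivative h (at x) v) \<le> e * norm x ^ s * norm v"
      using Suc by (intro step) auto
    moreover have "\<forall>\<^sub>F x in nhds 0. x \<in> U" using assms(1,2) eventually_nhds_in_open by blast
    ultimately have "\<forall>\<^sub>F x in nhds 0. x \<in> U \<and>
        (\<forall>v. norm (frechet_derivative h (at x) v) \<le> e * norm x ^ s * norm v)"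
      by eventually_elim blast
    then obtain d where d: "d > 0" "\<And>x. norm x < d \<Longrightarrow> x \<in> U"
      "\<And>x v. norm x < d \<Longrightarrow> norm (frechet_derivative h (at x) v) \<le> e * norm x ^ s * norm v"
      unfolding eventually_nhds_metric by auto
    have der: "(h has_derivative frechet_derivative h (at x)) (at x)" if "norm x < d" for x
      using Suc.prems(1) d(2)[OF that] by (simp add: Cr_on_Suc frechet_derivative_works)
    have "norm (h x) \<le> (e * norm x ^ s) * norm x" if x: "norm x < d" for x
    proof (rule norm_le_if_derivative_le[of h x "\<lambda>y. frechet_derivative h (at y)"])
      show "isCont h 0" using has_derivative_continuous[OF der[of 0]] d(1) by simp
      show "h 0 = 0" using Suc.prems(2)[of "[]"] by simp
      fix y v :: 'b assume y: "norm y \<le> norm x"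
      then show "(h has_derivative frechet_derivative h (at y)) (at y)" using der x by simp
      have "e * norm y ^ s * norm v \<le> e * norm x ^ s * norm v"
        using y Suc.prems(3) by (intro mult_right_mono mult_left_mono power_mono) auto
      then show "norm (frechet_derivative h (at y) v) \<le> e * norm x ^ s * norm v"
        using d(3)[of y v] x y by simp
    qed
    then show ?case
      unfolding eventually_nhds_metric using d(1) by (auto simp: mult_ac)
  qed
  show "\<forall>\<^sub>F x in nhds 0. norm (h x) \<le> e * norm x ^ r" using main assms(3-5) by blast
  show "\<forall>\<^sub>F x in nhds 0. \<forall>v. norm (frechet_derivative h (at x) v) \<le> e * norm x ^ s * norm v"
    if "r = Suc s"
    using assms(3-5) that by (intro step main) auto
qed

text \<open>The necessary conditions on the 1-jets of germs with vanishing r-jet. Conversely, by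
  \<open>flat_germ_interpolation\<close>, any 1-jets along a sparse sequence that obey such bounds
  with factors tending to 0 occur.\<close>

lemma flat_germ_small:
  fixes h :: "'b::euclidean_space \<Rightarrow> 'c::real_inner"
  assumes h: "flat_germ r h" and "e > 0"
  shows "\<forall>\<^sub>F x in at 0. h differentiable (at x) \<and> norm (h x) \<le> e * norm x ^ r \<and>
    (\<forall>v. norm x * norm (frechet_derivative h (at x) v) \<le> e * norm x ^ r * norm v)"
proof -
  have diff: "\<forall>\<^sub>F x in at 0. h differentiable (at x)"
    using h Cr_germ_differentiable unfolding flat_germ_def by blast
  show ?thesis
  proof (cases r)
    case 0
    then obtain U where U: "open U" "0 \<in> U" "continuous_on U h" and h0: "h 0 = 0"
      using h unfolding flat_germ_def Cr_germ_def by auto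
    have 1: "\<forall>\<^sub>F x in at 0. norm (h x) \<le> e"
    proof -
      have "iter_deriv h vs 0 = 0" if "length vs \<le> 0" for vs using that h0 by simp
      then have "\<forall>\<^sub>F x in nhds 0. norm (h x) \<le> e"
        using Cr_on_zero_jet_small(1)[of U 0 h e] U \<open>e > 0\<close> by (simp add: Cr_on_0)
      then show ?thesis using eventually_nhds_conv_at by blast
    qed
    have 2: "\<forall>\<^sub>F x in at 0. norm (onorm (\<lambda>v. 0 - frechet_derivative h (at x) v)) \<le> e * norm (1 / norm x)"
      using h 0 \<open>e > 0\<close> unfolding flat_germ_def jet_equiv_def by (auto dest: landau_o.smallD)
    have 3: "\<forall>\<^sub>F x in at 0. x \<noteq> (0::'b)" by (simp add: eventually_at_filter)
    show ?thesis using diff 1 2 3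
    proof eventually_elim
      case (elim x)
      have bl: "bounded_linear (frechet_derivative h (at x))"
        using has_derivative_frechet[OF elim(1)] has_derivative_bounded_linear by blast
      have "onorm (frechet_derivative h (at x)) \<le> e / norm x"
        using elim(3) by (simp add: onorm_neg)
      then have "norm (frechet_derivative h (at x) v) \<le> e / norm x * norm v" for v
        using onorm[OF bl, of v] mult_right_mono[of _ _ "norm v"] by (meson norm_ge_zero order_trans)
      then have "norm x * norm (frechet_derivative h (at x) v) \<le> e * norm v" for v
        using elim(4) by (simp add: field_simps)
      then show ?case using elim 0 by simp
    qed
  next
    case (Suc s)
    then obtain U where U: "open U" "0 \<in> U" "Cr_on r h U"
      and j: "\<And>vs. length vs \<le> r \<Longrightarrow> iter_deriv h vs 0 = 0"
      using h unfolding flat_germ_def Cr_germ_def jet_equiv_def by auto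
    have "\<forall>\<^sub>F x in at 0. norm (h x) \<le> e * norm x ^ r"
      "\<forall>\<^sub>F x in at 0. \<forall>v. norm (frechet_derivative h (at x) v) \<le> e * norm x ^ s * norm v"
      using Cr_on_zero_jet_small[OF U j \<open>e > 0\<close>] Suc eventually_nhds_conv_at by blast+
    with diff show ?thesis
    proof eventually_elim
      case (elim x)
      have "norm x * norm (frechet_derivative h (at x) v) \<le> norm x * (e * norm x ^ s * norm v)" for v
        using elim(3) by (intro mult_left_mono) auto
      then show ?case using elim Suc by (simp add: mult_ac)
    qed
  qed
qed

text \<open>
  The bounds on (v, L) are those satisfied by the 1-jets at x of the germs with vanishing r-jet;
  they are multiplied by |x| in the second case so as to make sense for r = 0.
\<close>

definition jet_condition ::
    "nat \<Rightarrow> ('b::euclidean_space \<Rightarrow> 'c::real_normed_vector) \<Rightarrow> ('b \<Rightarrow> 'c \<Rightarrow> ('b \<Rightarrow> 'c) \<Rightarrow> bool) \<Rightarrow> bool"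
  where
  "jet_condition r f P \<longleftrightarrow> (\<exists>e>0. \<forall>x v L. x \<noteq> 0 \<and> norm x < e \<and> linear L \<and>
     norm v \<le> e * norm x ^ r \<and> (\<forall>h. norm x * norm (L h) \<le> e * norm x ^ r * norm h) \<longrightarrow>
     P x (f x + v) (\<lambda>h. frechet_derivative f (at x) h + L h))"

text \<open>From right to left g - f is small by \<open>flat_germ_small\<close>. Conversely, if no e
  works, there are bad 1-jets for every e; one germ h interpolates a sparse sequence of them, and f
  + h violates P arbitrarily close to 0. P is arbitrary because it is used both for transversality
  to W and for avoiding S.\<close>

lemma jet_condition_iff:
  fixes f :: "'b::euclidean_space \<Rightarrow> 'c::real_inner"
  assumes f: "smooth_map f" "f 0 = 0"
  shows "(\<forall>g. Cr_germ r g \<and> jet_equiv r f g \<longrightarrow>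
       (\<forall>\<^sub>F x in at 0. P x (g x) (frechet_derivative g (at x)))) \<longleftrightarrow> jet_condition r f P"
    (is "?l \<longleftrightarrow> ?r")
proof
  assume ?r
  then obtain e where e: "e > 0" "\<And>x v L. x \<noteq> 0 \<Longrightarrow> norm x < e \<Longrightarrow> linear L \<Longrightarrow>
     norm v \<le> e * norm x ^ r \<Longrightarrow> (\<And>h. norm x * norm (L h) \<le> e * norm x ^ r * norm h) \<Longrightarrow>
     P x (f x + v) (\<lambda>h. frechet_derivative f (at x) h + L h)"
    unfolding jet_condition_def by blast
  show ?l
  proof (intro allI impI, elim conjE)
    fix g assume "Cr_germ r g" "jet_equiv r f g"
    then have "flat_germ r (\<lambda>x. g x - f x)" using jet_imp_flat_germ f by blast
    from flat_germ_small[OF this e(1)]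
    have "\<forall>\<^sub>F x in at 0. (\<lambda>x. g x - f x) differentiable (at x) \<and> norm (g x - f x) \<le> e * norm x ^ r \<and>
      (\<forall>v. norm x * norm (frechet_derivative (\<lambda>x. g x - f x) (at x) v) \<le> e * norm x ^ r * norm v)" .
    moreover have "\<forall>\<^sub>F x in at 0. x \<noteq> (0::'b) \<and> norm x < e"
      using e(1) by (auto simp: eventually_at intro!: exI[of _ e])
    ultimately show "\<forall>\<^sub>F x in at 0. P x (g x) (frechet_derivative g (at x))"
    proof eventually_elim
      case (elim x)
      let ?L = "frechet_derivative (\<lambda>x. g x - f x) (at x)"
      have L: "((\<lambda>x. g x - f x) has_derivative ?L) (at x)"
        using elim(1) by (simp add: frechet_derivative_works)
      have "P x (f x + (g x - f x)) (\<lambda>h. frechet_derivative f (at x) h + ?L h)"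
        using elim has_derivative_linear[OF L] by (intro e(2)) auto
      moreover have "((\<lambda>x. f x + (g x - f x)) has_derivative
          (\<lambda>h. frechet_derivative f (at x) h + ?L h)) (at x)"
        by (intro has_derivative_add L has_derivative_frechet smooth_map_differentiable f)
      ultimately show ?case using frechet_derivative_at by fastforce
    qed
  qed
next
  assume l: ?l
  show ?r
  proof (rule ccontr)
    assume "\<not> ?r"
    define bad where "bad e x v L \<longleftrightarrow> x \<noteq> 0 \<and> norm x < e \<and> linear L \<and>
     norm v \<le> e * norm x ^ r \<and> (\<forall>h. norm x * norm (L h) \<le> e * norm x ^ r * norm h) \<and>
     \<not> P x (f x + v) (\<lambda>h. frechet_derivative f (at x) h + L h)" for e x v L
    have ex: "\<exists>x v L. bad e x v L" if "e > 0" for e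
      using \<open>\<not> ?r\<close> that unfolding jet_condition_def bad_def by blast
    have mono: "bad e' x v L" if "bad e x v L" "e \<le> e'" for e e' x v L
    proof -
      have "e * norm x ^ r \<le> e' * norm x ^ r" using that(2) by (intro mult_right_mono) auto
      then show ?thesis using that unfolding bad_def
        by (meson dual_order.trans less_le_trans mult_right_mono norm_ge_zero)
    qed
    \<comment> \<open>Dependent choice, since the bound on the next point involves the previous one:
      the minimum of 1 / Suc (Suc n) and half the previous norm gives both the shrinking scale and
      the sparseness.\<close>
    have "\<exists>s :: nat \<Rightarrow> 'b \<times> 'c \<times> ('b \<Rightarrow> 'c). \<forall>n.
        (case s n of (x, v, L) \<Rightarrow> bad (1 / Suc n) x v L) \<and> norm (fst (s (Suc n))) \<le> norm (fst (s n)) / 2"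
    proof (rule dependent_nat_choice)
      show "\<exists>s. case s of (x, v, L) \<Rightarrow> bad (1 / Suc 0) x v L" using ex[of 1] by auto
      fix s :: "'b \<times> 'c \<times> ('b \<Rightarrow> 'c)" and n
      assume "case s of (x, v, L) \<Rightarrow> bad (1 / Suc n) x v L"
      then have "fst s \<noteq> 0" by (auto simp: bad_def split: prod.splits)
      then have "min (1 / Suc (Suc n)) (norm (fst s) / 2) > 0" by simp
      from ex[OF this] obtain x v L where b: "bad (min (1 / Suc (Suc n)) (norm (fst s) / 2)) x v L"
        by blast
      then have "norm x \<le> norm (fst s) / 2" by (simp add: bad_def)
      with mono[OF b, of "1 / Suc (Suc n)"]
      show "\<exists>t. (case t of (x, v, L) \<Rightarrow> bad (1 / Suc (Suc n)) x v L) \<and> norm (fst t) \<le> norm (fst s) / 2"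
        by (intro exI[of _ "(x, v, L)"]) auto
    qed
    then obtain s :: "nat \<Rightarrow> 'b \<times> 'c \<times> ('b \<Rightarrow> 'c)" where
      "\<forall>n. (case s n of (x, v, L) \<Rightarrow> bad (1 / Suc n) x v L) \<and>
        norm (fst (s (Suc n))) \<le> norm (fst (s n)) / 2"
      by (elim exE) (rule that)
    then have s: "\<And>n. case s n of (x, v, L) \<Rightarrow> bad (1 / Suc n) x v L"
        "\<And>n. norm (fst (s (Suc n))) \<le> norm (fst (s n)) / 2" by simp_all
    define x v L where "x n = fst (s n)" and "v n = fst (snd (s n))" and "L n = snd (snd (s n))" for n
    have bad: "bad (1 / Suc n) (x n) (v n) (L n)" for n
      using s(1)[of n] by (simp add: x_def v_def L_def split: prod.splits)
    have "(\<lambda>n. 1 / Suc n) \<longlonglongrightarrow> 0" by real_asymp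
    then obtain h where h: "flat_germ r h" "\<And>n. h (x n) = v n"
      "\<And>n. (h has_derivative L n) (at (x n))"
      by (rule flat_germ_interpolation[of x L _ v r, rotated 3])
         (use bad s(2) in \<open>auto simp: bad_def x_def\<close>)
    have "\<forall>\<^sub>F x in at 0. P x (f x + h x) (frechet_derivative (\<lambda>x. f x + h x) (at x))"
      using l flat_germ_imp_jet[OF h(1) f] by blast
    moreover have "filterlim x (at 0) sequentially"
    proof (rule filterlim_atI)
      show "x \<longlonglongrightarrow> 0"
      proof (rule Lim_null_comparison)
        show "\<forall>\<^sub>F n in sequentially. norm (x n) \<le> 1 / Suc n"
          using bad by (auto simp: bad_def less_imp_le)
        show "(\<lambda>n. 1 / Suc n) \<longlonglongrightarrow> 0" by real_asymp
      qed
    qed (use bad in \<open>auto simp: bad_def\<close>)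
    ultimately have "\<forall>\<^sub>F n in sequentially.
        P (x n) (f (x n) + h (x n)) (frechet_derivative (\<lambda>x. f x + h x) (at (x n)))"
      by (auto simp: filterlim_iff)
    moreover have "\<not> P (x n) (f (x n) + h (x n)) (frechet_derivative (\<lambda>x. f x + h x) (at (x n)))" for n
    proof -
      have "frechet_derivative (\<lambda>x. f x + h x) (at (x n)) =
          (\<lambda>k. frechet_derivative f (at (x n)) k + L n k)"
        using has_derivative_add[OF has_derivative_frechet[OF smooth_map_differentiable[OF f(1)]] h(3)]
          frechet_derivative_at by metis
      then show ?thesis using bad[of n] h(2) by (simp add: bad_def)
    qed
    ultimately show False by simp
  qed
qed

section \<open>Product coordinates, graphs, and transversality in terms of 1-jets\<close>

definition base_part :: "'a^('n::finite + 'm::finite) \<Rightarrow> 'a^'n" where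
  "base_part w = (\<chi> i. w $ Inl i)"

definition fibre_part :: "'a^('n::finite + 'm::finite) \<Rightarrow> 'a^'m" where
  "fibre_part w = (\<chi> j. w $ Inr j)"

lemma join_nth [simp]: "join x y $ Inl i = x $ i" "join x y $ Inr j = y $ j"
  by (simp_all add: join_def)

lemma vec_sum_eq_iff: "v = w \<longleftrightarrow> (\<forall>i. v $ Inl i = w $ Inl i) \<and> (\<forall>j. v $ Inr j = w $ Inr j)"
  by (auto simp: vec_eq_iff split_sum_all)

lemma parts_join [simp]: "base_part (join x y) = x" "fibre_part (join x y) = y"
  by (simp_all add: base_part_def fibre_part_def vec_eq_iff)

lemma join_parts [simp]: "join (base_part w) (fibre_part w) = w"
  by (simp add: base_part_def fibre_part_def vec_sum_eq_iff)

lemma join_eq_iff [simp]: "join x y = join x' y' \<longleftrightarrow> x = x' \<and> y = y'"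
  by (metis parts_join)

lemma join_add: "join x y + join x' y' = join (x + x') (y + y')"
  by (simp add: vec_sum_eq_iff)

lemma join_diff: "join x y - join x' y' = join (x - x') (y - y')"
  by (simp add: vec_sum_eq_iff)

lemma join_0 [simp]: "join 0 0 = 0"
  by (simp add: vec_sum_eq_iff)

lemma bounded_linear_parts:
  "bounded_linear (base_part :: 'a::euclidean_space^('n::finite + 'm::finite) \<Rightarrow> _)"
  "bounded_linear (fibre_part :: 'a::euclidean_space^('n::finite + 'm::finite) \<Rightarrow> _)"
  unfolding linear_conv_bounded_linear[symmetric]
  by (auto intro!: linearI simp: base_part_def fibre_part_def vec_eq_iff)

lemma bounded_linear_join:
  "bounded_linear (\<lambda>p. join (fst p) (snd p) :: 'a::euclidean_space^('n::finite + 'm::finite))"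
  unfolding linear_conv_bounded_linear[symmetric]
  by (auto intro!: linearI simp: vec_sum_eq_iff)

lemma has_derivative_join:
  fixes f :: "'b::real_normed_vector \<Rightarrow> 'a::euclidean_space^'n::finite" and g :: "'b \<Rightarrow> 'a^'m::finite"
  assumes "(f has_derivative f') (at t)" "(g has_derivative g') (at t)"
  shows "((\<lambda>x. join (f x) (g x)) has_derivative (\<lambda>h. join (f' h) (g' h))) (at t)"
  using bounded_linear.has_derivative[OF bounded_linear_join has_derivative_Pair[OF assms]] by simp

lemma has_vector_derivative_join:
  fixes f :: "real \<Rightarrow> 'a::euclidean_space^'n::finite" and g :: "real \<Rightarrow> 'a^'m::finite"
  assumes "(f has_vector_derivative f') (at t)" "(g has_vector_derivative g') (at t)"
  shows "((\<lambda>x. join (f x) (g x)) has_vector_derivative join f' g') (at t)"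
proof -
  have "(\<lambda>h. join (h *\<^sub>R f') (h *\<^sub>R g')) = (\<lambda>h. h *\<^sub>R join f' g')"
    by (simp add: vec_sum_eq_iff fun_eq_iff)
  then show ?thesis
    using has_derivative_join[OF assms[unfolded has_vector_derivative_def]]
    by (simp add: has_vector_derivative_def)
qed

lemma norm_base_part_le:
  fixes w :: "'a::real_normed_vector^('n::finite + 'm::finite)"
  shows "norm (base_part w) \<le> norm w"
proof -
  have "(\<Sum>i\<in>UNIV. (norm (w $ Inl i))\<^sup>2) \<le> (\<Sum>s\<in>UNIV. (norm (w $ s))\<^sup>2)"
    using sum_mono2[of UNIV "range Inl" "\<lambda>s. (norm (w $ s))\<^sup>2"]
    by (simp add: sum.reindex[OF inj_Inl] o_def)
  then show ?thesis by (simp add: norm_vec_def L2_set_def base_part_def)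
qed

lemma mem_graph_of_iff: "w \<in> graph_of g \<longleftrightarrow> fibre_part w = g (base_part w)"
proof
  assume "fibre_part w = g (base_part w)"
  then have "w = join (base_part w) (g (base_part w))" using join_parts[of w] by simp
  then show "w \<in> graph_of g" unfolding graph_of_def by blast
qed (auto simp: graph_of_def)

text \<open>Continuity of g sends parameters x near 0 to points of the graph near 0; in the other
  direction the projection to the base does not increase norms. Because of g 0 = 0 the excluded
  points w = 0 and x = 0 match.\<close>

lemma eventually_graph_iff:
  fixes g :: "'a::euclidean_space^'n::finite \<Rightarrow> 'a^'m::finite"
  assumes "isCont g 0" "g 0 = 0"
  shows "(\<forall>\<^sub>F w in at 0. w \<in> graph_of g \<longrightarrow> Q w) \<longleftrightarrow> (\<forall>\<^sub>F x in at 0. Q (join x (g x)))"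
proof
  assume l: "\<forall>\<^sub>F w in at 0. w \<in> graph_of g \<longrightarrow> Q w"
  have "filterlim (\<lambda>x. join x (g x)) (at 0) (at 0)"
  proof (rule filterlim_atI)
    have "((\<lambda>x. (x, g x)) \<longlongrightarrow> (0, 0)) (at 0)"
      using assms by (intro tendsto_intros) (auto simp: isCont_def)
    then show "((\<lambda>x. join x (g x)) \<longlongrightarrow> 0) (at 0)"
      using bounded_linear.tendsto[OF bounded_linear_join] by fastforce
    show "\<forall>\<^sub>F x in at 0. join x (g x) \<noteq> 0"
      unfolding eventually_at_filter using join_eq_iff[of _ _ 0 0] by (auto intro!: always_eventually)
  qed
  from eventually_compose_filterlim[OF l this] show "\<forall>\<^sub>F x in at 0. Q (join x (g x))"
    by (simp add: mem_graph_of_iff)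
next
  assume "\<forall>\<^sub>F x in at 0. Q (join x (g x))"
  then obtain d where d: "d > 0" "\<And>x. x \<noteq> 0 \<Longrightarrow> norm x < d \<Longrightarrow> Q (join x (g x))"
    by (auto simp: eventually_at)
  have "Q w" if "w \<noteq> 0" "norm w < d" "w \<in> graph_of g" for w
  proof -
    have w: "w = join (base_part w) (g (base_part w))"
      using that(3) by (metis join_parts mem_graph_of_iff)
    then have "base_part w \<noteq> 0" using that(1) assms(2) by (metis join_0)
    moreover have "norm (base_part w) < d" using norm_base_part_le[of w] that(2) by simp
    ultimately show ?thesis using d(2) w by metis
  qed
  then show "\<forall>\<^sub>F w in at 0. w \<in> graph_of g \<longrightarrow> Q w"
    using d(1) by (auto simp: eventually_at)
qed

text \<open>A curve in the graph is determined by its base part, so the chain rule gives its fibre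
  velocity; conversely straight lines in the base realise every h.\<close>

lemma tangent_vectors_graph_of:
  fixes g :: "'a::euclidean_space^'n::finite \<Rightarrow> 'a^'m::finite"
  assumes g: "(g has_derivative D) (at x)"
  shows "tangent_vectors (graph_of g) (join x (g x)) = range (\<lambda>h. join h (D h))"
proof (intro equalityI subsetI)
  fix v assume "v \<in> tangent_vectors (graph_of g) (join x (g x))"
  then obtain \<gamma> :: "real \<Rightarrow> 'a^('n + 'm)" where \<gamma>: "\<gamma> 0 = join x (g x)"
    "(\<gamma> has_vector_derivative v) (at 0)" "\<forall>\<^sub>F t in at 0. \<gamma> t \<in> graph_of g"
    unfolding tangent_vectors_def by auto
  have bp: "((\<lambda>t. base_part (\<gamma> t)) has_vector_derivative base_part v) (at 0)"
    and fp: "((\<lambda>t. fibre_part (\<gamma> t)) has_vector_derivative fibre_part v) (at 0)"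
    by (rule bounded_linear.has_vector_derivative[OF bounded_linear_parts(1) \<gamma>(2)]
             bounded_linear.has_vector_derivative[OF bounded_linear_parts(2) \<gamma>(2)])+
  have "((\<lambda>t. g (base_part (\<gamma> t))) has_derivative (\<lambda>t. D (t *\<^sub>R base_part v))) (at 0)"
  proof (rule has_derivative_compose[where f = "\<lambda>t. base_part (\<gamma> t)" and g = g])
    show "((\<lambda>t. base_part (\<gamma> t)) has_derivative (\<lambda>t. t *\<^sub>R base_part v)) (at 0)"
      using bp by (simp add: has_vector_derivative_def)
    show "(g has_derivative D) (at (base_part (\<gamma> 0)))" using g \<gamma>(1) by simp
  qed
  then have gd: "((\<lambda>t. g (base_part (\<gamma> t))) has_vector_derivative D (base_part v)) (at 0)"
    using linear_scale[OF has_derivative_linear[OF g]] by (simp add: has_vector_derivative_def)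
  \<comment> \<open>In \<open>tangent_vectors\<close> membership is demanded for t near but
    different from 0; as \<open>\<gamma> 0\<close> is itself a point of the graph, t = 0 can be
    added.\<close>
  have "\<forall>\<^sub>F t in nhds 0. g (base_part (\<gamma> t)) = fibre_part (\<gamma> t)"
    using \<gamma>(3,1) by (simp add: eventually_nhds_conv_at mem_graph_of_iff eq_commute)
  then obtain N where N: "open N" "0 \<in> N" "\<And>t. t \<in> N \<Longrightarrow> g (base_part (\<gamma> t)) = fibre_part (\<gamma> t)"
    by (auto simp: eventually_nhds)
  have "((\<lambda>t. fibre_part (\<gamma> t)) has_vector_derivative D (base_part v)) (at 0)"
    by (rule has_vector_derivative_transform_within_open[OF gd N])
  from vector_derivative_unique_at[OF fp this] have "v = join (base_part v) (D (base_part v))"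
    using join_parts[of v] by simp
  then show "v \<in> range (\<lambda>h. join h (D h))" by blast
next
  fix v assume "v \<in> range (\<lambda>h. join h (D h))"
  then obtain h where v: "v = join h (D h)" by auto
  have l: "((\<lambda>t. x + t *\<^sub>R h) has_vector_derivative h) (at 0)"
    by (auto intro!: derivative_eq_intros)
  have "((\<lambda>t. g (x + t *\<^sub>R h)) has_derivative (\<lambda>t. D (t *\<^sub>R h))) (at 0)"
  proof (rule has_derivative_compose[where f = "\<lambda>t. x + t *\<^sub>R h" and g = g])
    show "((\<lambda>t. x + t *\<^sub>R h) has_derivative (\<lambda>t. t *\<^sub>R h)) (at 0)"
      using l by (simp add: has_vector_derivative_def)
    show "(g has_derivative D) (at (x + 0 *\<^sub>R h))" using g by simp
  qed
  then have "((\<lambda>t. g (x + t *\<^sub>R h)) has_vector_derivative D h) (at 0)"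
    using linear_scale[OF has_derivative_linear[OF g]] by (simp add: has_vector_derivative_def)
  from has_vector_derivative_join[OF l this]
  show "v \<in> tangent_vectors (graph_of g) (join x (g x))"
    unfolding tangent_vectors_def v
    by (auto intro!: exI[of _ "\<lambda>t. join (x + t *\<^sub>R h) (g (x + t *\<^sub>R h))"] simp: mem_graph_of_iff)
qed

text \<open>Transversality to W of any graph with the 1-jet (x, y, D): modulo the vectors
  \<open>join h (D h)\<close> tangent to the graph, every z is tangent to W. It is vacuous off W,
  which matches the implication in \<open>t_sub\<close>.\<close>

definition transverse_jet where
  "transverse_jet W x y D \<longleftrightarrow> (join x y \<in> W \<longrightarrow>
     (\<forall>z. \<exists>h. z - join h (D h) \<in> tangent_vectors W (join x y)))"

lemma transverse_at_graph_of:
  fixes g :: "'a::euclidean_space^'n::finite \<Rightarrow> 'a^'m::finite"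
  assumes "g differentiable (at x)"
  shows "transverse_at (graph_of g) W (join x (g x)) \<longleftrightarrow>
    (\<forall>z. \<exists>h. z - join h (frechet_derivative g (at x) h) \<in> tangent_vectors W (join x (g x)))"
    (is "_ \<longleftrightarrow> (\<forall>z. ?ex z)")
proof -
  have eq: "(\<exists>u v. z = u + v \<and> u \<in> tangent_vectors (graph_of g) (join x (g x)) \<and>
      v \<in> tangent_vectors W (join x (g x))) \<longleftrightarrow> ?ex z" (is "?l \<longleftrightarrow> _") for z
  proof
    assume ?l
    then obtain h v where "z = join h (frechet_derivative g (at x) h) + v"
      "v \<in> tangent_vectors W (join x (g x))"
      unfolding tangent_vectors_graph_of[OF has_derivative_frechet[OF assms]] by blast
    then show "?ex z" by (intro exI[of _ h]) simp
  next
    assume "?ex z"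
    then obtain h where "z - join h (frechet_derivative g (at x) h) \<in> tangent_vectors W (join x (g x))"
      by blast
    moreover have "z = join h (frechet_derivative g (at x) h) + (z - join h (frechet_derivative g (at x) h))"
      by simp
    ultimately show ?l
      unfolding tangent_vectors_graph_of[OF has_derivative_frechet[OF assms]] by blast
  qed
  show ?thesis unfolding transverse_at_def set_eq_iff mem_Collect_eq eq by simp
qed

lemma Cr_germ_isCont:
  assumes "Cr_germ r g" shows "isCont g 0"
proof -
  obtain U where "open U" "0 \<in> U" "continuous_on U g"
    using assms Cr_on_imp_continuous_on unfolding Cr_germ_def by (cases "r = 0") auto
  then show ?thesis by (simp add: continuous_on_eq_continuous_at)
qed

lemma t_sub_iff:
  fixes f :: "'a::{real_normed_field,euclidean_space}^'n::finite \<Rightarrow> 'a^'m::finite"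
  assumes f: "smooth_map f" "f 0 = 0"
  shows "t_sub r W f \<longleftrightarrow> jet_condition r f (transverse_jet W)"
  unfolding jet_condition_iff[OF f, symmetric] t_sub_def
proof (intro all_cong1 imp_cong refl)
  fix g assume g: "Cr_germ r g \<and> jet_equiv r f g"
  then have g0: "g 0 = 0" and c: "isCont g 0" using Cr_germ_isCont by (auto simp: Cr_germ_def)
  have "(\<forall>\<^sub>F w in at 0. w \<in> graph_of g \<inter> W \<longrightarrow> transverse_at (graph_of g) W w) \<longleftrightarrow>
    (\<forall>\<^sub>F w in at 0. w \<in> graph_of g \<longrightarrow> w \<in> W \<longrightarrow> transverse_at (graph_of g) W w)"
    by (simp add: imp_conjL)
  also have "\<dots> \<longleftrightarrow> (\<forall>\<^sub>F x in at 0. join x (g x) \<in> W \<longrightarrow> transverse_at (graph_of g) W (join x (g x)))"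
    by (rule eventually_graph_iff[OF c g0])
  also have "\<dots> \<longleftrightarrow> (\<forall>\<^sub>F x in at 0. transverse_jet W x (g x) (frechet_derivative g (at x)))"
  proof (rule eventually_subst)
    have "\<forall>\<^sub>F x in at 0. g differentiable (at x)" using Cr_germ_differentiable g by blast
    then show "\<forall>\<^sub>F x in at 0. (join x (g x) \<in> W \<longrightarrow> transverse_at (graph_of g) W (join x (g x))) =
        transverse_jet W x (g x) (frechet_derivative g (at x))"
      by eventually_elim (simp add: transverse_jet_def transverse_at_graph_of)
  qed
  finally show "(\<forall>\<^sub>F w in at 0. w \<in> graph_of g \<inter> W \<longrightarrow> transverse_at (graph_of g) W w) \<longleftrightarrow>
    (\<forall>\<^sub>F x in at 0. transverse_jet W x (g x) (frechet_derivative g (at x)))" .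
qed

text \<open>Avoiding S depends on the value of g alone, so it is also a predicate of 1-jets. As 0
  lies in S and on the graph, the equivalence in \<open>t_pair\<close> is true at 0, and elsewhere
  it says that the graph misses S.\<close>

lemma t_pair_iff:
  fixes f :: "'a::{real_normed_field,euclidean_space}^'n::finite \<Rightarrow> 'a^'m::finite"
  assumes f: "smooth_map f" "f 0 = 0" and S: "0 \<in> S"
  shows "t_pair r X S f \<longleftrightarrow> jet_condition r f (transverse_jet (X - S)) \<and>
    jet_condition r f (\<lambda>x y D. join x y \<notin> S)"
  unfolding t_pair_def t_sub_iff[OF f] jet_condition_iff[OF f, of r "\<lambda>x y D. join x y \<notin> S", symmetric]
proof (intro conj_cong all_cong1 imp_cong refl)
  fix g assume g: "Cr_germ r g \<and> jet_equiv r f g"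
  then have g0: "g 0 = 0" and c: "isCont g 0" using Cr_germ_isCont by (auto simp: Cr_germ_def)
  then have "0 \<in> graph_of g" by (metis join_0 mem_graph_of_iff parts_join)
  then have "(\<forall>\<^sub>F w in nhds 0. w \<in> graph_of g \<inter> S \<longleftrightarrow> w = 0) \<longleftrightarrow>
      (\<forall>\<^sub>F w in at 0. w \<in> graph_of g \<longrightarrow> w \<notin> S)"
    unfolding eventually_at_filter using S
    by (intro eventually_subst always_eventually) auto
  also have "\<dots> \<longleftrightarrow> (\<forall>\<^sub>F x in at 0. join x (g x) \<notin> S)"
    by (rule eventually_graph_iff[OF c g0])
  finally show "(\<forall>\<^sub>F w in nhds 0. w \<in> graph_of g \<inter> S \<longleftrightarrow> w = 0) \<longleftrightarrow>
     (\<forall>\<^sub>F x in at 0. join x (g x) \<notin> S)" .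
qed

section \<open>Transversality under the Grassmann modification\<close>

definition mat_app :: "'a::comm_semiring_1^('k::finite \<times> 'n::finite) \<Rightarrow> 'a^'n \<Rightarrow> 'a^'k" where
  "mat_app a x = (\<chi> i. \<Sum>j\<in>UNIV. a $ (i, j) * x $ j)"

text \<open>Up to the factor x_j this inverts a \<mapsto> a x. It is the source of the pointwise
  right inverse, of the lifting of curves and of polynomials, and of the non-uniqueness of
  lifts.\<close>

definition column :: "'n::finite \<Rightarrow> 'a::zero^'k::finite \<Rightarrow> 'a^('k \<times> 'n)" where
  "column j y = (\<chi> s. if snd s = j then y $ fst s else 0)"

lemma beta_join: "beta (join x a) = join x (mat_app a x)"
  by (simp add: beta_def mat_app_def vec_eq_iff split_sum_all)

lemma mat_app_column: "mat_app (column j y) x = x $ j *s (y :: 'a::comm_semiring_1^'k::finite)"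
proof -
  have "(\<Sum>j'\<in>UNIV. column j y $ (i, j') * x $ j') = (\<Sum>j'\<in>UNIV. if j' = j then x $ j * y $ i else 0)" for i
    by (rule sum.cong) (auto simp: column_def mult.commute)
  then show ?thesis by (simp add: mat_app_def vec_eq_iff)
qed

lemma column_0 [simp]: "column j 0 = 0"
  by (simp add: column_def vec_eq_iff)

lemma parts_diff:
  "base_part (v - w) = base_part v - base_part (w :: 'a::ab_group_add^('n::finite + 'm::finite))"
  "fibre_part (v - w) = fibre_part v - fibre_part w"
  by (simp_all add: base_part_def fibre_part_def vec_eq_iff)

lemma mat_app_smult: "mat_app (s *s a) x = s *s mat_app a (x :: 'a::comm_semiring_1^'n::finite)"
  by (simp add: mat_app_def vec_eq_iff sum_distrib_left mult.assoc)

lemma mat_app_add: "mat_app (a + b) x = mat_app a x + mat_app b (x :: 'a::comm_semiring_1^'n::finite)"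
  by (simp add: mat_app_def vec_eq_iff sum.distrib distrib_right)

lemma mat_app_sum: "mat_app (\<Sum>i\<in>I. f i) x = (\<Sum>i\<in>I. mat_app (f i) (x :: 'a::comm_semiring_1^'n::finite))"
proof (induction I rule: infinite_finite_induct)
  have "mat_app 0 x = 0" by (simp add: mat_app_def vec_eq_iff)
  then show "mat_app (sum f {}) x = (\<Sum>i\<in>{}. mat_app (f i) x)"
    "\<And>I. infinite I \<Longrightarrow> mat_app (sum f I) x = (\<Sum>i\<in>I. mat_app (f i) x)" by simp_all
qed (simp add: mat_app_add)

lemma bounded_bilinear_mat_app:
  "bounded_bilinear (mat_app :: 'a::{real_normed_field,euclidean_space}^('k::finite \<times> 'n::finite) \<Rightarrow> _)"
  unfolding bilinear_conv_bounded_bilinear[symmetric] bilinear_def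
  by (auto intro!: linearI
      simp: mat_app_def vec_eq_iff sum.distrib distrib_left distrib_right scaleR_sum_right)

lemma bounded_bilinear_smult:
  "bounded_bilinear ((*s) :: 'a::{real_normed_field,euclidean_space} \<Rightarrow> 'a^'k::finite \<Rightarrow> _)"
  unfolding bilinear_conv_bounded_bilinear[symmetric] bilinear_def
  by (auto intro!: linearI simp: vec_eq_iff distrib_left distrib_right)

lemma bounded_linear_column:
  "bounded_linear (column j :: 'a::euclidean_space^'k::finite \<Rightarrow> 'a^('k \<times> 'n::finite))"
  unfolding linear_conv_bounded_linear[symmetric]
  by (auto intro!: linearI simp: column_def vec_eq_iff)

text \<open>Division by a component of maximal norm costs no more than 1 / |x| up to a constant, by
  comparison with the sum of the norms of all components.\<close>

lemma exists_large_component: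
  fixes x :: "'a::real_normed_vector^'n::finite"
  assumes "x \<noteq> 0"
  obtains j where "x $ j \<noteq> 0" "norm x \<le> CARD('n) * norm (x $ j)"
proof -
  have "Max (range (\<lambda>i. norm (x $ i))) \<in> range (\<lambda>i. norm (x $ i))" by (intro Max_in) auto
  then obtain j where m: "Max (range (\<lambda>i. norm (x $ i))) = norm (x $ j)" by blast
  have j: "norm (x $ i) \<le> norm (x $ j)" for i
    unfolding m[symmetric] by (intro Max_ge) auto
  have "norm x \<le> (\<Sum>i\<in>UNIV. norm (x $ i))" by (simp add: norm_vec_def L2_set_le_sum)
  also have "\<dots> \<le> (\<Sum>i\<in>(UNIV :: 'n set). norm (x $ j))" using j by (intro sum_mono)
  finally have "norm x \<le> CARD('n) * norm (x $ j)" by simp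
  moreover from this have "x $ j \<noteq> 0" using assms by auto
  ultimately show thesis using that by blast
qed

text \<open>R y has y / x_j in column j, where x_j is a component of maximal norm. The index j may
  jump as x varies, but R is used at one fixed x at a time.\<close>

lemma mat_app_right_inverse:
  fixes x :: "'a::{real_normed_field,euclidean_space}^'n::finite"
  assumes "x \<noteq> 0"
  obtains R :: "'a^'k::finite \<Rightarrow> 'a^('k \<times> 'n)" where "linear R" "\<And>y. mat_app (R y) x = y"
    "\<And>y. norm x * norm (R y) \<le> CARD('n) * norm y"
proof -
  obtain j where j: "x $ j \<noteq> 0" "norm x \<le> CARD('n) * norm (x $ j)"
    using exists_large_component[OF assms] .
  define R :: "'a^'k \<Rightarrow> 'a^('k \<times> 'n)" where "R y = column j (inverse (x $ j) *s y)" for y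
  have norm_smult: "norm (s *s y) = norm s * norm y" for s :: 'a and y :: "'a^'k"
    by (simp add: norm_vec_def norm_mult L2_set_right_distrib)
  have norm_column: "norm (column j y :: 'a^('k \<times> 'n)) = norm y" for y :: "'a^'k"
  proof -
    have "(\<Sum>s\<in>UNIV. (norm ((column j y :: 'a^('k \<times> 'n)) $ s))\<^sup>2)
        = (\<Sum>i\<in>UNIV. \<Sum>j'\<in>UNIV. (norm (if j' = j then y $ i else 0))\<^sup>2)"
      unfolding sum.cartesian_product by (simp add: column_def case_prod_beta)
    also have "\<dots> = (\<Sum>i\<in>UNIV. (norm (y $ i))\<^sup>2)"
      by (simp add: if_distrib[of norm] if_distrib[of "\<lambda>t. t\<^sup>2"] cong: if_cong)
    finally show ?thesis by (simp add: norm_vec_def L2_set_def)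
  qed
  show thesis
  proof
    show "linear R"
      by (auto intro!: linearI simp: R_def column_def vec_eq_iff distrib_left)
    show "mat_app (R y) x = y" for y
      using j(1) by (simp add: R_def mat_app_column vec_eq_iff)
    show "norm x * norm (R y) \<le> CARD('n) * norm y" for y
    proof -
      have "norm x * norm (R y) = norm x / norm (x $ j) * norm y"
        by (simp add: R_def norm_column norm_smult norm_inverse divide_inverse)
      also have "norm x / norm (x $ j) \<le> CARD('n)" using j by (simp add: pos_divide_le_eq)
      finally show ?thesis by (simp add: mult_right_mono)
    qed
  qed
qed

definition dbeta :: "'a::comm_semiring_1^'n::finite \<Rightarrow> 'a^('k::finite \<times> 'n) \<Rightarrow> 'a^('n + ('k \<times> 'n)) \<Rightarrow> 'a^('n + 'k)"
  where "dbeta x a u = join (base_part u) (mat_app (fibre_part u) x + mat_app a (base_part u))"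

text \<open>One direction composes a curve with beta. In the other, a curve in W has to be lifted
  with prescribed velocity u: its base part is kept, and matrices over it are chosen that start at a
  with velocity \<open>fibre_part u\<close>.\<close>

lemma tangent_vectors_vimage_beta:
  fixes x :: "'a::{real_normed_field,euclidean_space}^'n::finite" and a :: "'a^('k::finite \<times> 'n)"
  assumes "x \<noteq> 0"
  shows "u \<in> tangent_vectors (beta -` W) (join x a) \<longleftrightarrow>
    dbeta x a u \<in> tangent_vectors W (join x (mat_app a x))"
proof
  assume "u \<in> tangent_vectors (beta -` W) (join x a)"
  then obtain \<gamma> :: "real \<Rightarrow> 'a^('n + ('k \<times> 'n))" where \<gamma>: "\<gamma> 0 = join x a"
    "(\<gamma> has_vector_derivative u) (at 0)" "\<forall>\<^sub>F t in at 0. beta (\<gamma> t) \<in> W"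
    unfolding tangent_vectors_def by auto
  have bp: "((\<lambda>t. base_part (\<gamma> t)) has_vector_derivative base_part u) (at 0)"
    by (rule bounded_linear.has_vector_derivative[OF bounded_linear_parts(1) \<gamma>(2)])
  have fp: "((\<lambda>t. fibre_part (\<gamma> t)) has_vector_derivative fibre_part u) (at 0)"
    by (rule bounded_linear.has_vector_derivative[OF bounded_linear_parts(2) \<gamma>(2)])
  have eq: "beta (\<gamma> t) = join (base_part (\<gamma> t)) (mat_app (fibre_part (\<gamma> t)) (base_part (\<gamma> t)))" for t
    using beta_join[of "base_part (\<gamma> t)" "fibre_part (\<gamma> t)"] by simp
  have "((\<lambda>t. beta (\<gamma> t)) has_vector_derivative dbeta x a u) (at 0)"
    using has_vector_derivative_join[OF bp
        bounded_bilinear.has_vector_derivative[OF bounded_bilinear_mat_app fp bp]] \<gamma>(1)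
    unfolding eq dbeta_def by (simp add: add.commute)
  then show "dbeta x a u \<in> tangent_vectors W (join x (mat_app a x))"
    unfolding tangent_vectors_def using \<gamma>(1,3)
    by (auto intro!: exI[of _ "\<lambda>t. beta (\<gamma> t)"] simp: beta_join)
next
  assume "dbeta x a u \<in> tangent_vectors W (join x (mat_app a x))"
  then obtain \<gamma> :: "real \<Rightarrow> 'a^('n + 'k)" where \<gamma>: "\<gamma> 0 = join x (mat_app a x)"
    "(\<gamma> has_vector_derivative dbeta x a u) (at 0)" "\<forall>\<^sub>F t in at 0. \<gamma> t \<in> W"
    unfolding tangent_vectors_def by auto
  have bp: "((\<lambda>t. base_part (\<gamma> t)) has_vector_derivative base_part u) (at 0)"
    using bounded_linear.has_vector_derivative[OF bounded_linear_parts(1) \<gamma>(2)]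
    by (simp add: dbeta_def)
  have fp: "((\<lambda>t. fibre_part (\<gamma> t)) has_vector_derivative
      mat_app (fibre_part u) x + mat_app a (base_part u)) (at 0)"
    using bounded_linear.has_vector_derivative[OF bounded_linear_parts(2) \<gamma>(2)]
    by (simp add: dbeta_def)
  obtain j where j: "x $ j \<noteq> 0" using assms by (auto simp: vec_eq_iff)
  define s where "s t = inverse (base_part (\<gamma> t) $ j)" for t
  \<comment> \<open>The straight line l has the required velocity, but its image misses \<gamma> by
    c. The velocity of \<gamma> makes c vanish to first order at t = 0, so adding c, divided by the
    j-th base coordinate, in column j repairs the image without changing the velocity.\<close>
  define l where "l t = a + t *\<^sub>R fibre_part u" for t :: real
  define c where "c t = fibre_part (\<gamma> t) - mat_app (l t) (base_part (\<gamma> t))" for t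
  define m where "m t = l t + column j (s t *s c t)" for t
  have l: "(l has_vector_derivative fibre_part u) (at 0)"
    unfolding l_def by (auto intro!: derivative_eq_intros)
  have c0: "c 0 = 0" by (simp add: c_def l_def \<gamma>(1))
  have c: "(c has_vector_derivative 0) (at 0)"
    using has_vector_derivative_diff[OF fp
        bounded_bilinear.has_vector_derivative[OF bounded_bilinear_mat_app l bp]]
    unfolding c_def by (simp add: l_def \<gamma>(1))
  have bj: "((\<lambda>t. base_part (\<gamma> t) $ j) has_vector_derivative base_part u $ j) (at 0)"
    by (rule bounded_linear.has_vector_derivative[OF bounded_linear_vec_nth bp])
  \<comment> \<open>Only the existence of s' matters: in the product rule it is multiplied by c 0 =
    0.\<close>
  obtain s' where s: "(s has_vector_derivative s') (at 0)"
  proof -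
    have "base_part (\<gamma> 0) $ j \<noteq> 0" using j \<gamma>(1) by simp
    from Deriv.has_derivative_inverse[OF this bj[unfolded has_vector_derivative_def]]
    have "(s has_derivative (\<lambda>h. - (inverse (base_part (\<gamma> 0) $ j) * (h *\<^sub>R base_part u $ j)
        * inverse (base_part (\<gamma> 0) $ j)))) (at 0)"
      unfolding s_def .
    then have "(s has_vector_derivative
        - (inverse (base_part (\<gamma> 0) $ j) * base_part u $ j * inverse (base_part (\<gamma> 0) $ j))) (at 0)"
      by (simp add: has_vector_derivative_def)
    then show thesis by (rule that)
  qed
  have "((\<lambda>t. s t *s c t) has_vector_derivative 0) (at 0)"
    using bounded_bilinear.has_vector_derivative[OF bounded_bilinear_smult s c] c0
    by (simp add: vec_eq_iff)
  from has_vector_derivative_add[OF l bounded_linear.has_vector_derivative[OF bounded_linear_column[of j] this]]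
  have "(m has_vector_derivative fibre_part u) (at 0)"
    unfolding m_def by simp
  from has_vector_derivative_join[OF bp this]
  have der: "((\<lambda>t. join (base_part (\<gamma> t)) (m t)) has_vector_derivative u) (at 0)" by simp
  have "\<forall>\<^sub>F t in at 0. base_part (\<gamma> t) $ j \<noteq> 0"
  proof -
    have "((\<lambda>t. base_part (\<gamma> t) $ j) \<longlongrightarrow> base_part (\<gamma> 0) $ j) (at 0)"
      using has_vector_derivative_continuous[OF bj] by (simp add: continuous_at)
    then show ?thesis using j \<gamma>(1) by (intro tendsto_imp_eventually_ne) auto
  qed
  with \<gamma>(3) have "\<forall>\<^sub>F t in at 0. beta (join (base_part (\<gamma> t)) (m t)) \<in> W"
  proof eventually_elim
    case (elim t)
    have "mat_app (m t) (base_part (\<gamma> t)) = fibre_part (\<gamma> t)"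
      using elim(2) by (simp add: m_def mat_app_add mat_app_column s_def c_def vec_eq_iff)
    then show ?case using elim(1) by (simp add: beta_join)
  qed
  moreover have "join (base_part (\<gamma> 0)) (m 0) = join x a"
    by (simp add: m_def c0 \<gamma>(1) l_def vec.scale_zero_right)
  ultimately show "u \<in> tangent_vectors (beta -` W) (join x a)"
    unfolding tangent_vectors_def using der
    by (auto intro!: exI[of _ "\<lambda>t. join (base_part (\<gamma> t)) (m t)"])
qed

text \<open>By the product rule the differential of beta sends the tangent vector
  \<open>join h (A h)\<close> of a graph to one of the image graph, and it is onto because of the
  right inverse. As the tangent vectors upstairs are the full preimage of those of W, solvability
  for all z means the same in both places.\<close>

lemma transverse_jet_vimage_beta:
  fixes x :: "'a::{real_normed_field,euclidean_space}^'n::finite" and a :: "'a^('k::finite \<times> 'n)"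
  assumes "x \<noteq> 0"
  shows "transverse_jet (beta -` W) x a A \<longleftrightarrow>
    transverse_jet W x (mat_app a x) (\<lambda>h. mat_app (A h) x + mat_app a h)"
proof -
  have lin: "mat_app (b - b') x = mat_app b x - mat_app b' x" "mat_app b (y - y') = mat_app b y - mat_app b y'"
    for b b' :: "'a^('k \<times> 'n)" and y y' :: "'a^'n"
    using bounded_bilinear.diff_left[OF bounded_bilinear_mat_app]
      bounded_bilinear.diff_right[OF bounded_bilinear_mat_app] by blast+
  have d: "dbeta x a (z - join h (A h)) = dbeta x a z - join h (mat_app (A h) x + mat_app a h)" for z h
    by (simp add: dbeta_def lin join_diff parts_diff)
  obtain R :: "'a^'k \<Rightarrow> 'a^('k \<times> 'n)" where R: "\<And>y. mat_app (R y) x = y"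
    using mat_app_right_inverse[OF assms] by metis
  have "surj (dbeta x a)"
  proof (rule surjI)
    fix z
    show "dbeta x a (join (base_part z) (R (fibre_part z - mat_app a (base_part z)))) = z"
      by (simp add: dbeta_def R)
  qed
  then have "(\<forall>z. \<exists>h. dbeta x a z - join h (mat_app (A h) x + mat_app a h) \<in> T) \<longleftrightarrow>
      (\<forall>z. \<exists>h. z - join h (mat_app (A h) x + mat_app a h) \<in> T)" for T
    by (metis surjD)
  then show ?thesis
    unfolding transverse_jet_def tangent_vectors_vimage_beta[OF assms] d by (simp add: beta_join)
qed

text \<open>Perturbing the 1-jet of p at x by (v, L) changes that of p x * x by v x and h \<mapsto>
  (L h) x + v h. To get the condition for p, this map is bounded by the norm C of the
  multiplication; to get the condition for the product, it is solved for (v, L) by the right inverse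
  R.\<close>

lemma jet_condition_transfer:
  fixes p :: "'a::{real_normed_field,euclidean_space}^'n::finite \<Rightarrow> 'a^('k::finite \<times> 'n)"
  assumes p: "\<And>x. p differentiable (at x)"
    and P: "\<And>x a A. x \<noteq> 0 \<Longrightarrow> P' x a A \<longleftrightarrow> P x (mat_app a x) (\<lambda>h. mat_app (A h) x + mat_app a h)"
  shows "jet_condition (Suc r) (\<lambda>x. mat_app (p x) x) P \<longleftrightarrow> jet_condition r p P'"
proof
  note B = bounded_bilinear_mat_app[where 'a='a and 'k='k and 'n='n]
  have Dq: "frechet_derivative (\<lambda>x. mat_app (p x) x) (at x) h
      = mat_app (p x) h + mat_app (frechet_derivative p (at x) h) x" for x h
    using frechet_derivative_eqI[OF bounded_bilinear.FDERIV[OF B has_derivative_frechet[OF p] has_derivative_ident]] .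
  obtain C where C: "C > 0" "\<And>a x. norm (mat_app (a :: 'a^('k \<times> 'n)) x) \<le> norm a * norm x * C"
    using bounded_bilinear.pos_bounded[OF B] by blast
  {
    assume "jet_condition (Suc r) (\<lambda>x. mat_app (p x) x) P"
    then obtain e where e: "e > 0" "\<And>x v L. x \<noteq> 0 \<Longrightarrow> norm x < e \<Longrightarrow> linear L \<Longrightarrow>
       norm v \<le> e * norm x ^ Suc r \<Longrightarrow> (\<And>h. norm x * norm (L h) \<le> e * norm x ^ Suc r * norm h) \<Longrightarrow>
       P x (mat_app (p x) x + v) (\<lambda>h. frechet_derivative (\<lambda>x. mat_app (p x) x) (at x) h + L h)"
      unfolding jet_condition_def by blast
    \<comment> \<open>The two terms of h \<mapsto> (L h) x + v h get half of e each.\<close>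
    define e' where "e' = min e (e / (2 * C))"
    have e': "e' > 0" "e' \<le> e" "e' * C \<le> e / 2"
      using e(1) C(1) by (auto simp: e'_def min_def field_simps)
    show "jet_condition r p P'"
      unfolding jet_condition_def
    proof (intro exI[of _ e'] conjI allI impI, rule e'(1), elim conjE)
      fix x :: "'a^'n" and v :: "'a^('k \<times> 'n)" and L :: "'a^'n \<Rightarrow> 'a^('k \<times> 'n)"
      assume x: "x \<noteq> 0" "norm x < e'" and L: "linear L" and v: "norm v \<le> e' * norm x ^ r"
        and Lb: "\<forall>h. norm x * norm (L h) \<le> e' * norm x ^ r * norm h"
      have v': "norm (mat_app v y) \<le> e / 2 * norm x ^ r * norm y" for y
      proof -
        have "norm (mat_app v y) \<le> (e' * norm x ^ r) * norm y * C"
          using C v by (meson mult_right_mono norm_ge_zero order_trans less_imp_le)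
        also have "\<dots> = (e' * C) * (norm x ^ r * norm y)" by simp
        also have "\<dots> \<le> (e / 2) * (norm x ^ r * norm y)" using e'(3) by (intro mult_right_mono) auto
        finally show ?thesis by simp
      qed
      have L': "norm (mat_app (L h) x) \<le> e / 2 * norm x ^ r * norm h" for h
      proof -
        have "norm (mat_app (L h) x) \<le> (norm x * norm (L h)) * C" using C(2)[of "L h" x] by (simp add: mult_ac)
        also have "\<dots> \<le> (e' * norm x ^ r * norm h) * C" using Lb C(1) by (intro mult_right_mono) auto
        also have "\<dots> = (e' * C) * (norm x ^ r * norm h)" by simp
        also have "\<dots> \<le> (e / 2) * (norm x ^ r * norm h)" using e'(3) by (intro mult_right_mono) auto
        finally show ?thesis by simp
      qed
      have "P x (mat_app (p x) x + mat_app v x)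
         (\<lambda>h. frechet_derivative (\<lambda>x. mat_app (p x) x) (at x) h + (mat_app (L h) x + mat_app v h))"
      proof (rule e(2)[OF x(1)])
        show "norm x < e" using x(2) e'(2) by simp
        show "linear (\<lambda>h. mat_app (L h) x + mat_app v h)"
          using bounded_bilinear.bounded_linear_left[OF B, of x] bounded_bilinear.bounded_linear_right[OF B, of v]
          by (intro linear_compose_add linear_compose[OF L, unfolded o_def, of "\<lambda>a. mat_app a x"])
             (auto intro: bounded_linear.linear)
        have "e / 2 * norm x ^ r * norm x \<le> e * norm x ^ r * norm x"
          using e(1) by (intro mult_right_mono) auto
        then show "norm (mat_app v x) \<le> e * norm x ^ Suc r"
          using v'[of x] by (simp add: mult_ac)
        fix h
        have "norm (mat_app (L h) x + mat_app v h)
            \<le> e / 2 * norm x ^ r * norm h + e / 2 * norm x ^ r * norm h"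
          by (rule norm_triangle_mono[OF L' v'])
        also have "\<dots> = e * norm x ^ r * norm h" by (simp add: field_simps)
        finally have "norm (mat_app (L h) x + mat_app v h) \<le> e * norm x ^ r * norm h" .
        then have "norm x * norm (mat_app (L h) x + mat_app v h) \<le> norm x * (e * norm x ^ r * norm h)"
          by (intro mult_left_mono) auto
        then show "norm x * norm (mat_app (L h) x + mat_app v h) \<le> e * norm x ^ Suc r * norm h"
          by (simp add: mult_ac)
      qed
      then show "P' x (p x + v) (\<lambda>h. frechet_derivative p (at x) h + L h)"
        unfolding P[OF x(1)] by (simp add: Dq mat_app_add add_ac)
    qed
  next
    assume "jet_condition r p P'"
    then obtain e where e: "e > 0" "\<And>x v L. x \<noteq> 0 \<Longrightarrow> norm x < e \<Longrightarrow> linear L \<Longrightarrow>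
       norm v \<le> e * norm x ^ r \<Longrightarrow> (\<And>h. norm x * norm (L h) \<le> e * norm x ^ r * norm h) \<Longrightarrow>
       P' x (p x + v) (\<lambda>h. frechet_derivative p (at x) h + L h)"
      unfolding jet_condition_def by blast
    define N where "N = real CARD('n)"
    have N: "N \<ge> 1" by (simp add: N_def Suc_leI)
    \<comment> \<open>In the definition of L' below, R contributes the outer N, the given L
      contributes 1 and the correction by R v contributes C * N; R v itself is covered by N <=
      K.\<close>
    define K where "K = N * (1 + C * N)"
    have "C * N > 0" using N C(1) by simp
    then have K: "K > 0" "N \<le> K"
      using N mult_left_mono[of 1 "1 + C * N" N] by (auto simp: K_def)
    define e' where "e' = min e (e / K)"
    have e': "e' > 0" "e' \<le> e" "e' * K \<le> e"
      using e(1) K by (auto simp: e'_def min_def field_simps)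
    show "jet_condition (Suc r) (\<lambda>x. mat_app (p x) x) P"
      unfolding jet_condition_def
    proof (intro exI[of _ e'] conjI allI impI, rule e'(1), elim conjE)
      fix x :: "'a^'n" and v :: "'a^'k" and L :: "'a^'n \<Rightarrow> 'a^'k"
      assume x: "x \<noteq> 0" "norm x < e'" and L: "linear L" and v: "norm v \<le> e' * norm x ^ Suc r"
        and Lb: "\<forall>h. norm x * norm (L h) \<le> e' * norm x ^ Suc r * norm h"
      obtain R :: "'a^'k \<Rightarrow> 'a^('k \<times> 'n)" where R: "linear R" "\<And>y. mat_app (R y) x = y"
        "\<And>y. norm x * norm (R y) \<le> N * norm y"
        using mat_app_right_inverse[OF x(1)] unfolding N_def by metis
      have nx: "norm x > 0" using x(1) by simp
      \<comment> \<open>Here one power of |x| cancels, which takes order r + 1 to order r.\<close>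
      have "norm x * norm (R v) \<le> N * (e' * norm x ^ Suc r)"
        using R(3)[of v] v N by (meson mult_left_mono order_trans zero_le_one)
      then have "norm x * norm (R v) \<le> norm x * (N * e' * norm x ^ r)" by (simp add: mult_ac)
      then have Rv: "norm (R v) \<le> N * e' * norm x ^ r" using nx by simp
      have L1: "norm (L h) \<le> e' * norm x ^ r * norm h" for h
      proof -
        have "norm x * norm (L h) \<le> norm x * (e' * norm x ^ r * norm h)" using Lb by (simp add: mult_ac)
        then show ?thesis using nx by simp
      qed
      \<comment> \<open>Solves \<open>mat_app (L' h) x + mat_app (R v) h = L h\<close>, the
        derivative part of the perturbation.\<close>
      define L' where "L' h = R (L h - mat_app (R v) h)" for h
      have lin: "linear L'"
        using bounded_bilinear.bounded_linear_right[OF B, of "R v"] unfolding L'_def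
        by (intro linear_compose[OF linear_compose_sub[OF L] R(1), unfolded o_def])
           (auto intro: bounded_linear.linear)
      have "P' x (p x + R v) (\<lambda>h. frechet_derivative p (at x) h + L' h)"
      proof (rule e(2)[OF x(1) _ lin])
        show "norm x < e" using x(2) e'(2) by simp
        have "N * e' * norm x ^ r \<le> K * e' * norm x ^ r" using K e'(1) by (intro mult_right_mono) auto
        also have "\<dots> \<le> e * norm x ^ r" using e'(3) by (intro mult_right_mono) (auto simp: mult.commute)
        finally show "norm (R v) \<le> e * norm x ^ r" using Rv by simp
        fix h
        have "norm (mat_app (R v) h) \<le> norm (R v) * norm h * C" by (rule C(2))
        also have "\<dots> \<le> (N * e' * norm x ^ r) * norm h * C"
          using Rv C(1) by (intro mult_right_mono) auto
        finally have "norm (L h - mat_app (R v) h) \<le> e' * norm x ^ r * norm h + N * e' * norm x ^ r * norm h * C"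
          using norm_triangle_le_diff[OF add_mono[OF L1[of h]]] by blast
        then have "N * norm (L h - mat_app (R v) h)
            \<le> N * (e' * norm x ^ r * norm h + N * e' * norm x ^ r * norm h * C)"
          using N by (intro mult_left_mono) auto
        also have "\<dots> = (e' * K) * (norm x ^ r * norm h)" by (simp add: K_def algebra_simps)
        also have "\<dots> \<le> e * (norm x ^ r * norm h)" using e'(3) by (intro mult_right_mono) auto
        finally show "norm x * norm (L' h) \<le> e * norm x ^ r * norm h"
          using R(3)[of "L h - mat_app (R v) h"] by (simp add: L'_def)
      qed
      then show "P x (mat_app (p x) x + v) (\<lambda>h. frechet_derivative (\<lambda>x. mat_app (p x) x) (at x) h + L h)"
        unfolding P[OF x(1)] by (simp add: Dq mat_app_add R(2) L'_def add_ac)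
    qed
  }
qed

section \<open>Polynomial maps and lifts\<close>

lemma Cr_on_monomial_at:
  "Cr_on m (monomial_at \<alpha> :: 'a::{real_normed_field,euclidean_space}^'i::finite \<Rightarrow> 'a) UNIV"
proof -
  note mult = Cr_on_bilinear[OF bounded_bilinear_mult open_UNIV]
  have pow: "Cr_on m (\<lambda>z :: 'a^'i. z $ i ^ k) UNIV" for i k
  proof (induction k)
    case (Suc k)
    from mult[OF Cr_on_bounded_linear[OF bounded_linear_vec_nth] this] show ?case by simp
  qed (simp add: Cr_on_const)
  have "Cr_on m (\<lambda>z :: 'a^'i. \<Prod>i\<in>I. z $ i ^ \<alpha> i) UNIV" for I
  proof (induction I rule: infinite_finite_induct)
    case (insert i I)
    with mult[OF pow[of i "\<alpha> i"] insert.IH] show ?case by simp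
  qed (simp_all add: Cr_on_const)
  then show ?thesis by (simp add: monomial_at_def[abs_def])
qed

lemma smooth_map_polynomial:
  fixes q :: "'a::{real_normed_field,euclidean_space}^'i::finite \<Rightarrow> 'a^'p::finite"
  assumes "polynomial_map r q"
  shows "smooth_map q"
proof -
  obtain c where q: "q = (\<lambda>x. \<Sum>\<alpha> | (\<Sum>i\<in>UNIV. \<alpha> i) \<le> r. monomial_at \<alpha> x *s c \<alpha>)"
    using assms unfolding polynomial_map_def by blast
  have "Cr_on m (\<lambda>x :: 'a^'i. monomial_at \<alpha> x *s c \<alpha>) UNIV" for m \<alpha>
    by (rule Cr_on_compose_bounded_linear[OF bounded_bilinear.bounded_linear_left[OF bounded_bilinear_smult]
          open_UNIV Cr_on_monomial_at])
  then show ?thesis unfolding smooth_map_def q by (intro allI Cr_on_sum[OF open_UNIV])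
qed

lemma finite_multi_indices: "finite {\<alpha> :: 'i::finite \<Rightarrow> nat. (\<Sum>i\<in>UNIV. \<alpha> i) \<le> r}"
proof (rule finite_subset)
  show "{\<alpha> :: 'i \<Rightarrow> nat. (\<Sum>i\<in>UNIV. \<alpha> i) \<le> r} \<subseteq> Pi\<^sub>E UNIV (\<lambda>_. {..r})"
  proof
    fix \<alpha> :: "'i \<Rightarrow> nat" assume "\<alpha> \<in> {\<alpha>. (\<Sum>i\<in>UNIV. \<alpha> i) \<le> r}"
    then have sum_le: "(\<Sum>i\<in>UNIV. \<alpha> i) \<le> r" by simp
    have "\<alpha> i \<le> r" for i
      using member_le_sum[of i UNIV \<alpha>] sum_le by simp
    then show "\<alpha> \<in> Pi\<^sub>E UNIV (\<lambda>_. {..r})" by auto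
  qed
qed (simp add: finite_PiE)

lemma polynomial_map_0: "polynomial_map r (\<lambda>x. 0)"
  unfolding polynomial_map_def by (intro exI[of _ "\<lambda>_. 0"]) simp

lemma polynomial_map_add:
  assumes "polynomial_map r f" "polynomial_map r g"
  shows "polynomial_map r (\<lambda>x. f x + g x)"
proof -
  obtain c d where "\<forall>x. f x = (\<Sum>\<alpha> | (\<Sum>i\<in>UNIV. \<alpha> i) \<le> r. monomial_at \<alpha> x *s c \<alpha>)"
    "\<forall>x. g x = (\<Sum>\<alpha> | (\<Sum>i\<in>UNIV. \<alpha> i) \<le> r. monomial_at \<alpha> x *s d \<alpha>)"
    using assms unfolding polynomial_map_def by blast
  then show ?thesis unfolding polynomial_map_def
    by (intro exI[of _ "\<lambda>\<alpha>. c \<alpha> + d \<alpha>"]) (simp add: vector_add_ldistrib sum.distrib)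
qed

lemma polynomial_map_sum:
  "(\<And>i. i \<in> I \<Longrightarrow> polynomial_map r (f i)) \<Longrightarrow> polynomial_map r (\<lambda>x. \<Sum>i\<in>I. f i x)"
proof (induction I rule: infinite_finite_induct)
  case (insert i I)
  then show ?case using polynomial_map_add[of r "f i" "\<lambda>x. \<Sum>i\<in>I. f i x"] by simp
qed (simp_all add: polynomial_map_0)

lemma polynomial_map_monomial:
  assumes "(\<Sum>i\<in>UNIV. \<alpha> i) \<le> r"
  shows "polynomial_map r (\<lambda>x. monomial_at \<alpha> x *s v)"
  unfolding polynomial_map_def
proof (intro exI[of _ "\<lambda>\<beta>. if \<beta> = \<alpha> then v else 0"] allI)
  fix x
  have "(\<Sum>\<beta> | (\<Sum>i\<in>UNIV. \<beta> i) \<le> r. monomial_at \<beta> x *s (if \<beta> = \<alpha> then v else 0)) =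
      (\<Sum>\<beta> | (\<Sum>i\<in>UNIV. \<beta> i) \<le> r. if \<beta> = \<alpha> then monomial_at \<alpha> x *s v else 0)"
    by (rule sum.cong) auto
  then show "monomial_at \<alpha> x *s v = (\<Sum>\<beta> | (\<Sum>i\<in>UNIV. \<beta> i) \<le> r. monomial_at \<beta> x *s (if \<beta> = \<alpha> then v else 0))"
    using assms by (simp add: finite_multi_indices)
qed

lemma polynomial_map_const: "polynomial_map r (\<lambda>x. v)"
  using polynomial_map_monomial[of "\<lambda>_. 0" r v] by (simp add: monomial_at_def)

lemma monomial_at_Suc: "monomial_at (\<alpha>(j := Suc (\<alpha> j))) x = x $ j * monomial_at \<alpha> x"
proof -
  have "monomial_at (\<alpha>(j := Suc (\<alpha> j))) x = x $ j ^ Suc (\<alpha> j) * (\<Prod>i\<in>UNIV - {j}. x $ i ^ \<alpha> i)"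
    unfolding monomial_at_def by (subst prod.remove[of _ j]) (auto intro!: arg_cong2[of _ _ _ _ "(*)"] prod.cong)
  moreover have "monomial_at \<alpha> x = x $ j ^ \<alpha> j * (\<Prod>i\<in>UNIV - {j}. x $ i ^ \<alpha> i)"
    unfolding monomial_at_def by (subst prod.remove[of _ j]) auto
  ultimately show ?thesis by (simp add: mult.assoc)
qed

lemma sum_multi_index_Suc: "(\<Sum>i\<in>UNIV. (\<alpha>(j := Suc (\<alpha> j))) i) = Suc (\<Sum>i\<in>UNIV. \<alpha> (i::'i::finite))"
proof -
  have "(\<Sum>i\<in>UNIV. (\<alpha>(j := Suc (\<alpha> j))) i) = Suc (\<alpha> j) + (\<Sum>i\<in>UNIV - {j}. \<alpha> i)"
    by (subst sum.remove[of _ j]) (auto intro!: sum.cong)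
  moreover have "(\<Sum>i\<in>UNIV. \<alpha> i) = \<alpha> j + (\<Sum>i\<in>UNIV - {j}. \<alpha> i)"
    by (subst sum.remove[of _ j]) auto
  ultimately show ?thesis by simp
qed

text \<open>The product a x is the sum of x_j times the j-th column of a, so each monomial of p
  contributes monomials of one degree more.\<close>

lemma polynomial_map_mat_app:
  fixes p :: "'a::comm_semiring_1^'n::finite \<Rightarrow> 'a^('k::finite \<times> 'n)"
  assumes "polynomial_map r p"
  shows "polynomial_map (r + 1) (\<lambda>x. mat_app (p x) x)"
proof -
  obtain c where c: "\<And>x. p x = (\<Sum>\<alpha> | (\<Sum>i\<in>UNIV. \<alpha> i) \<le> r. monomial_at \<alpha> x *s c \<alpha>)"
    using assms unfolding polynomial_map_def by blast
  have decomp: "mat_app a x = (\<Sum>j\<in>UNIV. x $ j *s (\<chi> i. a $ (i, j)))" for a :: "'a^('k \<times> 'n)" and x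
    by (simp add: mat_app_def vec_eq_iff mult.commute)
  have "mat_app (p x) x = (\<Sum>\<alpha> | (\<Sum>i\<in>UNIV. \<alpha> i) \<le> r. \<Sum>j\<in>UNIV.
      monomial_at (\<alpha>(j := Suc (\<alpha> j))) x *s (\<chi> i. c \<alpha> $ (i, j)))" for x
    unfolding c mat_app_sum mat_app_smult
    by (simp add: decomp monomial_at_Suc vec_eq_iff sum_distrib_left mult_ac)
  then have "(\<lambda>x. mat_app (p x) x) = (\<lambda>x. \<Sum>\<alpha> | (\<Sum>i\<in>UNIV. \<alpha> i) \<le> r. \<Sum>j\<in>UNIV.
      monomial_at (\<alpha>(j := Suc (\<alpha> j))) x *s (\<chi> i. c \<alpha> $ (i, j)))" by (rule ext)
  moreover have "polynomial_map (r + 1) \<dots>"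
  proof (rule polynomial_map_sum, rule polynomial_map_sum, rule polynomial_map_monomial)
    fix \<alpha> and j :: 'n
    assume "\<alpha> \<in> {\<alpha> :: 'n \<Rightarrow> nat. (\<Sum>i\<in>UNIV. \<alpha> i) \<le> r}"
    then show "(\<Sum>i\<in>UNIV. (\<alpha>(j := Suc (\<alpha> j))) i) \<le> r + 1"
      unfolding sum_multi_index_Suc by simp
  qed
  ultimately show ?thesis by simp
qed

text \<open>A graph determines its map, so the equality of sets in \<open>is_lift\<close> is an
  identity of maps.\<close>

lemma is_lift_iff: "is_lift r q p \<longleftrightarrow> polynomial_map r p \<and> q = (\<lambda>x. mat_app (p x) x)"
proof -
  have "beta ` graph_of p = graph_of (\<lambda>x. mat_app (p x) x)"
    by (simp add: graph_of_def image_image beta_join)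
  moreover have "graph_of f = graph_of g \<longleftrightarrow> f = g" for f g :: "'a^'b \<Rightarrow> 'a^'c"
  proof
    assume eq: "graph_of f = graph_of g"
    show "f = g"
    proof
      fix x
      have "join x (f x) \<in> graph_of g" unfolding eq[symmetric] by (simp add: mem_graph_of_iff)
      then show "f x = g x" by (simp add: mem_graph_of_iff)
    qed
  qed simp
  ultimately show ?thesis unfolding is_lift_def by auto
qed

text \<open>Since q 0 = 0, each monomial of q contains some variable x_j. Removing one factor x_j
  and placing the coefficient in column j gives a summand of p.\<close>

lemma lift_exists:
  fixes q :: "'a::comm_semiring_1^'n::finite \<Rightarrow> 'a^'k::finite"
  assumes "polynomial_map (r + 1) q" "q 0 = 0"
  shows "\<exists>p. is_lift r q p"
proof -
  let ?A = "{\<alpha> :: 'n \<Rightarrow> nat. (\<Sum>i\<in>UNIV. \<alpha> i) \<le> r + 1}" and ?z = "\<lambda>_ :: 'n. 0 :: nat"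
  obtain c where c: "\<And>x. q x = (\<Sum>\<alpha>\<in>?A. monomial_at \<alpha> x *s c \<alpha>)"
    using assms(1) unfolding polynomial_map_def by blast
  \<comment> \<open>Evaluation at 0 isolates the constant coefficient, with 0 ^ 0 = 1.\<close>
  have "monomial_at \<alpha> (0 :: 'a^'n) = (if \<alpha> = ?z then 1 else 0)" for \<alpha>
  proof (cases "\<alpha> = ?z")
    case False
    then obtain j where "\<alpha> j \<noteq> 0" by auto
    then have "(\<Prod>i\<in>UNIV. (0 :: 'a^'n) $ i ^ \<alpha> i) = 0"
      by (subst prod.remove[of _ j]) (auto simp: power_0_left)
    then show ?thesis using False by (simp add: monomial_at_def)
  qed (simp add: monomial_at_def)
  then have "q 0 = (\<Sum>\<alpha>\<in>?A. if \<alpha> = ?z then c ?z else 0)"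
    unfolding c by (intro sum.cong) auto
  then have "q 0 = c ?z" by (simp add: finite_multi_indices)
  then have c0: "c ?z = 0" using assms(2) by simp
  \<comment> \<open>An arbitrary variable occurring in the monomial; different choices can lead to
    different lifts.\<close>
  define J where "J \<alpha> = (SOME j. \<alpha> j \<noteq> 0)" for \<alpha> :: "'n \<Rightarrow> nat"
  have J: "\<alpha> (J \<alpha>) \<noteq> 0" if "\<alpha> \<noteq> ?z" for \<alpha>
    unfolding J_def by (rule someI_ex) (use that in auto)
  define d where "d \<alpha> = \<alpha>(J \<alpha> := \<alpha> (J \<alpha>) - 1)" for \<alpha>
  have d: "\<alpha> = (d \<alpha>)(J \<alpha> := Suc (d \<alpha> (J \<alpha>)))" if "\<alpha> \<noteq> ?z" for \<alpha>
    using J[OF that] by (auto simp: d_def)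
  define p where "p x = (\<Sum>\<alpha>\<in>?A - {?z}. monomial_at (d \<alpha>) x *s column (J \<alpha>) (c \<alpha>))" for x
  have "polynomial_map r p" unfolding p_def
  proof (rule polynomial_map_sum, rule polynomial_map_monomial)
    fix \<alpha> assume "\<alpha> \<in> ?A - {?z}"
    then show "(\<Sum>i\<in>UNIV. d \<alpha> i) \<le> r"
      using sum_multi_index_Suc[of "d \<alpha>" "J \<alpha>"] d[of \<alpha>] by simp
  qed
  moreover have "q x = mat_app (p x) x" for x
  proof -
    have "q x = (\<Sum>\<alpha>\<in>?A - {?z}. monomial_at \<alpha> x *s c \<alpha>)"
      unfolding c using c0 by (subst sum.remove[of _ ?z]) (auto simp: finite_multi_indices)
    also have "\<dots> = (\<Sum>\<alpha>\<in>?A - {?z}. monomial_at (d \<alpha>) x *s (x $ J \<alpha> *s c \<alpha>))"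
    proof (rule sum.cong)
      fix \<alpha> assume "\<alpha> \<in> ?A - {?z}"
      then have "monomial_at \<alpha> x = x $ J \<alpha> * monomial_at (d \<alpha>) x"
        using monomial_at_Suc[of "d \<alpha>" "J \<alpha>" x] d[of \<alpha>] by simp
      then show "monomial_at \<alpha> x *s c \<alpha> = monomial_at (d \<alpha>) x *s (x $ J \<alpha> *s c \<alpha>)"
        by (simp add: vec_eq_iff mult_ac)
    qed simp
    finally show ?thesis by (simp add: p_def mat_app_sum mat_app_smult mat_app_column)
  qed
  ultimately show ?thesis unfolding is_lift_iff by blast
qed

text \<open>The relation x_j * x_i - x_i * x_j = 0 of degree 2: the matrix with x_j in column i and
  - x_i in column j has degree 1 and annihilates x, so it can be added to any lift.\<close>

lemma lift_not_unique:
  fixes p :: "'a::{comm_ring_1}^'n::finite \<Rightarrow> 'a^('k::finite \<times> 'n)"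
  assumes "is_lift r q p" "CARD('n) \<ge> 2" "r \<ge> 1"
  shows "\<exists>p'. is_lift r q p' \<and> p \<noteq> p'"
proof -
  have "\<not> is_singleton (UNIV :: 'n set)" using assms(2) by (simp add: is_singleton_altdef)
  then obtain i j :: 'n where ij: "i \<noteq> j" using is_singletonI'[of "UNIV :: 'n set"] by blast
  define e where "e j = (\<lambda>_ :: 'n. 0 :: nat)(j := Suc 0)" for j
  have e: "monomial_at (e j) x = x $ j" "(\<Sum>i\<in>UNIV. e j i) \<le> r" for j and x :: "'a^'n"
    using monomial_at_Suc[of "\<lambda>_. 0" j x] sum_multi_index_Suc[of "\<lambda>_. 0" j] assms(3)
    by (auto simp: e_def monomial_at_def simp del: fun_upd_apply)
  define k :: "'a^'n \<Rightarrow> 'a^('k \<times> 'n)" where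
    "k x = x $ j *s column i (\<chi> _. 1) + x $ i *s column j (\<chi> _. - 1)" for x
  have "polynomial_map r k"
    unfolding k_def e(1)[symmetric]
    by (intro polynomial_map_add[OF polynomial_map_monomial polynomial_map_monomial] e(2))
  moreover have "mat_app (k x) x = 0" for x
    by (simp add: k_def mat_app_add mat_app_smult mat_app_column vec_eq_iff mult.commute)
  ultimately have "is_lift r q (\<lambda>x. p x + k x)"
    using assms(1) polynomial_map_add unfolding is_lift_iff by (auto simp: mat_app_add)
  \<comment> \<open>At the vector of ones, column i consists of ones because i differs from j;
    \<open>undefined\<close> stands for some row.\<close>
  moreover have "k (\<chi> _. 1) \<noteq> 0"
  proof
    assume "k (\<chi> _. 1) = 0"
    then have "k (\<chi> _. 1) $ (undefined, i) = 0" by simp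
    then show False using ij by (simp add: k_def column_def)
  qed
  then have "p \<noteq> (\<lambda>x. p x + k x)" by (metis add_cancel_right_right)
  ultimately show ?thesis by blast
qed

section \<open>Translation to points of the modified Y, and the correspondence along a lift\<close>

lemma mem_shift_to_origin: "w \<in> shift_to_origin c A \<longleftrightarrow> w + c \<in> A"
proof
  assume "w + c \<in> A"
  then show "w \<in> shift_to_origin c A"
    unfolding shift_to_origin_def by (intro image_eqI[of _ _ "w + c"]) auto
qed (auto simp: shift_to_origin_def)

lemma tangent_vectors_shift_to_origin:
  "tangent_vectors (shift_to_origin c A) w = tangent_vectors A (w + c)"
proof (intro equalityI subsetI)
  fix v assume "v \<in> tangent_vectors (shift_to_origin c A) w"
  then obtain \<gamma> :: "real \<Rightarrow> 'a" where "\<gamma> 0 = w" "(\<gamma> has_vector_derivative v) (at 0)"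
    "\<forall>\<^sub>F t in at 0. \<gamma> t + c \<in> A"
    unfolding tangent_vectors_def mem_shift_to_origin by auto
  then show "v \<in> tangent_vectors A (w + c)"
    unfolding tangent_vectors_def
    by (auto intro!: exI[of _ "\<lambda>t. \<gamma> t + c"] derivative_eq_intros)
next
  fix v assume "v \<in> tangent_vectors A (w + c)"
  then obtain \<gamma> :: "real \<Rightarrow> 'a" where "\<gamma> 0 = w + c" "(\<gamma> has_vector_derivative v) (at 0)"
    "\<forall>\<^sub>F t in at 0. \<gamma> t \<in> A"
    unfolding tangent_vectors_def by auto
  then show "v \<in> tangent_vectors (shift_to_origin c A) w"
    unfolding tangent_vectors_def mem_shift_to_origin
    by (auto intro!: exI[of _ "\<lambda>t. \<gamma> t - c"] derivative_eq_intros)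
qed

lemma transverse_jet_shift:
  "transverse_jet (shift_to_origin (join 0 b) W) x y D \<longleftrightarrow> transverse_jet W x (y + b) D"
  by (simp add: transverse_jet_def mem_shift_to_origin tangent_vectors_shift_to_origin join_add)

lemma jet_condition_shift:
  fixes p :: "'b::euclidean_space \<Rightarrow> 'c::real_normed_vector"
  assumes "\<And>x. p differentiable (at x)" "\<And>x y D. P' x y D \<longleftrightarrow> P x (y + b) D"
  shows "jet_condition r (\<lambda>x. p x - b) P' \<longleftrightarrow> jet_condition r p P"
proof -
  have "frechet_derivative (\<lambda>x. p x - b) (at x) = frechet_derivative p (at x)" for x
    using frechet_derivative_at[OF has_derivative_diff[OF has_derivative_frechet[OF assms(1)] has_derivative_const]]
    by simp
  then show ?thesis unfolding jet_condition_def assms(2) by (simp add: algebra_simps)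
qed

context
  fixes q :: "'a::{real_normed_field,euclidean_space}^'n::finite \<Rightarrow> 'a^'k::finite"
    and p :: "'a^'n \<Rightarrow> 'a^('k \<times> 'n)" and r :: nat
  assumes lift: "is_lift r q p"
begin

text \<open>The map \<open>p - p 0\<close> is p seen from the point (0, p 0), which is moved to the
  origin together with the sets. The passage along beta leads from P to P', the condition at the
  untranslated point, and the translation from P' to P''.\<close>

lemma lift_jet_condition:
  assumes "\<And>x a A. x \<noteq> 0 \<Longrightarrow> P' x a A \<longleftrightarrow> P x (mat_app a x) (\<lambda>h. mat_app (A h) x + mat_app a h)"
    and "\<And>x y D. P'' x y D \<longleftrightarrow> P' x (y + p 0) D"
  shows "jet_condition (r + 1) q P \<longleftrightarrow> jet_condition r (\<lambda>x. p x - p 0) P''"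
proof -
  have q: "q = (\<lambda>x. mat_app (p x) x)" and "p differentiable (at x)" for x
    using lift smooth_map_differentiable[OF smooth_map_polynomial] unfolding is_lift_iff by auto
  then show ?thesis
    using jet_condition_transfer[of p P' P r] jet_condition_shift[of p P'' P' "p 0" r] assms by simp
qed

lemma lift_smooth:
  "smooth_map q" "q 0 = 0" "smooth_map (\<lambda>x. p x - p 0)"
proof -
  have p: "polynomial_map r p" and q: "q = (\<lambda>x. mat_app (p x) x)"
    using lift unfolding is_lift_iff by auto
  show "smooth_map q" unfolding q by (rule smooth_map_polynomial[OF polynomial_map_mat_app[OF p]])
  show "q 0 = 0" unfolding q by (simp add: mat_app_def vec_eq_iff)
  show "smooth_map (\<lambda>x. p x - p 0)"
    using smooth_map_polynomial[OF polynomial_map_add[OF p polynomial_map_const[of r "- p 0"]]] by simp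
qed

lemma lift_transverse_jet:
  "jet_condition (r + 1) q (transverse_jet W) \<longleftrightarrow> jet_condition r (\<lambda>x. p x - p 0)
      (transverse_jet (shift_to_origin (join 0 (p 0)) (beta -` W)))"
  by (rule lift_jet_condition[where P = "transverse_jet W" and P' = "transverse_jet (beta -` W)"
        and P'' = "transverse_jet (shift_to_origin (join 0 (p 0)) (beta -` W))",
        OF transverse_jet_vimage_beta transverse_jet_shift])

lemma lift_t_sub:
  "t_sub (r + 1) W q \<longleftrightarrow>
   t_sub r (shift_to_origin (join 0 (p 0)) (beta -` W)) (\<lambda>x. p x - p 0)"
proof -
  have "t_sub (r + 1) W q \<longleftrightarrow> jet_condition (r + 1) q (transverse_jet W)"
    by (rule t_sub_iff[OF lift_smooth(1,2)])
  also have "\<dots> \<longleftrightarrow> jet_condition r (\<lambda>x. p x - p 0)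
      (transverse_jet (shift_to_origin (join 0 (p 0)) (beta -` W)))"
    by (rule lift_transverse_jet)
  also have "\<dots> \<longleftrightarrow> t_sub r (shift_to_origin (join 0 (p 0)) (beta -` W)) (\<lambda>x. p x - p 0)"
    by (rule t_sub_iff[OF lift_smooth(3), symmetric]) simp
  finally show ?thesis .
qed

lemma lift_t_pair:
  assumes "0 \<in> S"
  shows "t_pair (r + 1) X S q \<longleftrightarrow>
   t_pair r (shift_to_origin (join 0 (p 0)) (beta -` X)) (shift_to_origin (join 0 (p 0)) (beta -` S))
     (\<lambda>x. p x - p 0)"
proof -
  let ?s = "shift_to_origin (join 0 (p 0))"
  \<comment> \<open>Preimages and translations commute with differences, so the regular part of the
    translated pair is the translated modification of X - S.\<close>
  have d: "?s (beta -` X) - ?s (beta -` S) = ?s (beta -` (X - S))"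
    by (auto simp: mem_shift_to_origin)
  \<comment> \<open>beta contracts the set x = 0 to the origin, so the modification of S contains
    all points of the modified Y.\<close>
  have "mat_app (p 0) 0 = 0" by (simp add: mat_app_def vec_eq_iff)
  then have 0: "0 \<in> ?s (beta -` S)" using assms by (simp add: mem_shift_to_origin beta_join)
  have S: "jet_condition (r + 1) q (\<lambda>x y D. join x y \<notin> S) \<longleftrightarrow>
      jet_condition r (\<lambda>x. p x - p 0) (\<lambda>x y D. join x y \<notin> ?s (beta -` S))"
    by (rule lift_jet_condition[where P' = "\<lambda>x y D. join x y \<notin> beta -` S"])
       (simp_all add: beta_join mem_shift_to_origin join_add)
  have W: "jet_condition (r + 1) q (transverse_jet (X - S)) \<longleftrightarrow>
      jet_condition r (\<lambda>x. p x - p 0) (transverse_jet (?s (beta -` (X - S))))"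
    by (rule lift_transverse_jet)
  show ?thesis
    using t_pair_iff[OF lift_smooth(1,2) assms] t_pair_iff[OF lift_smooth(3) _ 0] S W d by simp
qed

end

text \<open>The quantifiers correspond: a lift p of q gives the point (0, p 0) and the map
  \<open>p - p 0\<close>; conversely a point (0, b) and a map p' come from q x = (p' x + b) x, which
  p' + b lifts. The abstract t and t' cover W and the pair (X, S) alike.\<close>

lemma regular_iff:
  fixes t :: "('a::{real_normed_field,euclidean_space}^'n::finite \<Rightarrow> 'a^'k::finite) \<Rightarrow> bool"
    and t' :: "'a^('n + ('k \<times> 'n)) \<Rightarrow> ('a^'n \<Rightarrow> 'a^('k \<times> 'n)) \<Rightarrow> bool"
  assumes "\<And>q p. is_lift r q p \<Longrightarrow> t q \<longleftrightarrow> t' (join 0 (p 0)) (\<lambda>x. p x - p 0)"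
  shows "(\<forall>q. polynomial_map (r + 1) q \<and> q 0 = 0 \<longrightarrow> t q) \<longleftrightarrow>
    (\<forall>c\<in>Yspace. \<forall>p. polynomial_map r p \<and> p 0 = 0 \<longrightarrow> t' c p)" (is "?l \<longleftrightarrow> ?r")
proof
  assume l: ?l
  show ?r
  proof (intro ballI allI impI, elim conjE)
    fix c :: "'a^('n + ('k \<times> 'n))" and p' :: "'a^'n \<Rightarrow> 'a^('k \<times> 'n)"
    assume "c \<in> Yspace" and p': "polynomial_map r p'" "p' 0 = 0"
    then have c: "c = join 0 (fibre_part c)"
      by (simp add: Yspace_def fibre_part_def vec_sum_eq_iff)
    define p where "p x = p' x + fibre_part c" for x
    have lift: "is_lift r (\<lambda>x. mat_app (p x) x) p"
      unfolding is_lift_iff p_def using polynomial_map_add[OF p'(1) polynomial_map_const] by simp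
    have "polynomial_map (r + 1) (\<lambda>x. mat_app (p x) x)"
      using lift polynomial_map_mat_app unfolding is_lift_iff by blast
    with l have "t (\<lambda>x. mat_app (p x) x)" by (simp add: mat_app_def vec_eq_iff)
    then show "t' c p'" using assms[OF lift] c p'(2) by (simp add: p_def)
  qed
next
  assume r: ?r
  show ?l
  proof (intro allI impI, elim conjE)
    fix q :: "'a^'n \<Rightarrow> 'a^'k" assume "polynomial_map (r + 1) q" "q 0 = 0"
    then obtain p where p: "is_lift r q p" using lift_exists by blast
    have "polynomial_map r (\<lambda>x. p x + - p 0)"
      using p polynomial_map_add[OF _ polynomial_map_const] unfolding is_lift_iff by blast
    moreover have "join 0 (p 0) \<in> Yspace" by (simp add: Yspace_def)
    ultimately have "t' (join 0 (p 0)) (\<lambda>x. p x - p 0)"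
      using r[rule_format, of "join 0 (p 0)" "\<lambda>x. p x - p 0"] by simp
    then show "t q" using assms[OF p] by simp
  qed
qed

theorem theorem2p13:
  fixes F :: "'a::{real_normed_field,euclidean_space}^('n::finite + 'k::finite) \<Rightarrow> 'a^'p::finite"
    and U X W S :: "('a^('n + 'k)) set"
    and e r :: nat
  assumes "open U" and "0 \<in> U" and "F 0 = 0" and "analytic_map_on F U"
    and X: "X = {w \<in> U. F w = 0}"
    and e: "e = germ_codim (X - Yspace)"
    and W: "W = {w \<in> X - Yspace. rank (jacobian F (at w)) = e}"
    and S: "S = X - W"
    and dense: "\<exists>V. open V \<and> 0 \<in> V \<and> (X - Yspace) \<inter> V \<subseteq> closure W"
  shows
    "(t_regular_sub (r + 1) W 0 \<longleftrightarrow>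
        (\<forall>c \<in> (Yspace :: ('a^('n + ('k \<times> 'n))) set). t_regular_sub r (beta -` W) c)) \<and>
     (t_regular_pair (r + 1) X S 0 \<longleftrightarrow>
        (\<forall>c \<in> (Yspace :: ('a^('n + ('k \<times> 'n))) set). t_regular_pair r (beta -` X) (beta -` S) c)) \<and>
     (\<forall>q :: 'a^'n \<Rightarrow> 'a^'k. polynomial_map (r + 1) q \<and> q 0 = 0 \<longrightarrow>
        (\<exists>p. is_lift r q p) \<and>
        (CARD('n) \<ge> 2 \<and> r \<ge> 1 \<longrightarrow> (\<exists>p p'. is_lift r q p \<and> is_lift r q p' \<and> p \<noteq> p')) \<and>
        (\<forall>p. is_lift r q p \<longrightarrow>
           (t_sub (r + 1) W q \<longleftrightarrow>
              t_sub r (shift_to_origin (join 0 (p 0)) (beta -` W)) (\<lambda>x. p x - p 0)) \<and>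
           (t_pair (r + 1) X S q \<longleftrightarrow>
              t_pair r (shift_to_origin (join 0 (p 0)) (beta -` X))
                       (shift_to_origin (join 0 (p 0)) (beta -` S)) (\<lambda>x. p x - p 0))))"
proof -
  \<comment> \<open>0 lies in X, because F 0 = 0, and in Y, which W avoids.\<close>
  have "0 \<in> S" using assms(2,3) unfolding S W X by (simp add: Yspace_def)
  note sub = lift_t_sub[where W = W] and pair = lift_t_pair[OF _ this, where X = X]
  have s0: "shift_to_origin 0 A = A" for A :: "('a^('n + 'k)) set"
    by (simp add: shift_to_origin_def)
  show ?thesis
  proof (intro conjI allI impI, goal_cases)
    case 1
    show ?case unfolding t_regular_sub_def s0
      by (rule regular_iff[where t = "t_sub (r + 1) W"
            and t' = "\<lambda>c. t_sub r (shift_to_origin c (beta -` W))", OF sub])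
  next
    case 2
    show ?case unfolding t_regular_pair_def s0
      by (rule regular_iff[where t = "t_pair (r + 1) X S"
            and t' = "\<lambda>c. t_pair r (shift_to_origin c (beta -` X)) (shift_to_origin c (beta -` S))", OF pair])
  next
    case (3 q)
    then show ?case using lift_exists by blast
  next
    case (4 q)
    then show ?case using lift_exists lift_not_unique by blast
  next
    case (5 q p)
    then show ?case using sub by blast
  next
    case (6 q p)
    then show ?case using pair by blast
  qed
qed

end
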